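(* For every bridgeless graph $G$ and every $p\in[1,\infty]$, $\phi_{3,p}(G)\le 1+\sqrt2$.
   Context: All graphs are finite and may have multiple edges but no loops. For an orientation $D$ and vertex $v$, $E_D^+(v)$, $E_D^-(v)$ are the out- and in-edges. For $\Omega\subseteq\mathbb{R}^d$, a vector $\Omega$-flow of $G$ is $(D,f)$ with $f:E(G)\to\Omega$ and $\sum_{e\in E_D^+(v)}f(e)-\sum_{e\in E_D^-(v)}f(e)=\mathbf{0}$ at every vertex. $\|x\|_p$ is the usual $p$-norm, $\|x\|_\infty=\max_i|x_i|$. For integer $d\ge1$, real $r\ge2$, $p\in[1,\infty]$, an $(r,d,p)$-NZF of $G$ is a vector $(\mathbb{R}^d\setminus\{\mathbf{0}\})$-flow $(D,f)$ with $1\le\|f(e)\|_p\le r-1$ for all edges. For a bridgeless graph $G$, $\phi_{d,p}(G)$ is the infimum of real $r$ such that $G$ admits an $(r,d,p)$-NZF. *)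

theory Defs
  imports "HOL-Analysis.Analysis" "Graph_Theory.Digraph"
begin

record ('v, 'e) mgraph =
  vertices :: "'v set"
  edges :: "'e set"
  ends :: "'e \<Rightarrow> 'v set"

text \<open>Distinct elements of \<^term>\<open>edges G\<close> may have the same ends (multiple edges);
  requiring exactly two ends rules out loops. The graph without vertices is allowed.\<close>

definition finite_multigraph :: "('v, 'e) mgraph \<Rightarrow> bool" where
  "finite_multigraph G \<longleftrightarrow> finite (vertices G) \<and> finite (edges G) \<and>
     (\<forall>e \<in> edges G. ends G e \<subseteq> vertices G \<and> card (ends G e) = 2)"

definition adjacency :: "('v, 'e) mgraph \<Rightarrow> ('v \<times> 'v) set" where
  "adjacency G = {(u, v). \<exists>e \<in> edges G. ends G e = {u, v}}"

definition delete_edge :: "('v, 'e) mgraph \<Rightarrow> 'e \<Rightarrow> ('v, 'e) mgraph" where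
  "delete_edge G e = G\<lparr>edges := edges G - {e}\<rparr>"

text \<open>A bridge is an edge that separates its ends.\<close>

definition bridge :: "('v, 'e) mgraph \<Rightarrow> 'e \<Rightarrow> bool" where
  "bridge G e \<longleftrightarrow> e \<in> edges G \<and>
     (\<exists>u v. ends G e = {u, v} \<and> (u, v) \<notin> (adjacency (delete_edge G e))\<^sup>*)"

definition bridgeless :: "('v, 'e) mgraph \<Rightarrow> bool" where
  "bridgeless G \<longleftrightarrow> (\<forall>e. \<not> bridge G e)"

definition orientation :: "('v, 'e) mgraph \<Rightarrow> ('v, 'e) pre_digraph \<Rightarrow> bool" where
  "orientation G D \<longleftrightarrow> verts D = vertices G \<and> arcs D = edges G \<and>
     (\<forall>e \<in> edges G. {tail D e, head D e} = ends G e)"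

definition vector_flow ::
  "(real ^ 'd) set \<Rightarrow> ('v, 'e) mgraph \<Rightarrow> ('v, 'e) pre_digraph \<Rightarrow> ('e \<Rightarrow> real ^ 'd) \<Rightarrow> bool"
where
  "vector_flow \<Omega> G D f \<longleftrightarrow> orientation G D \<and> (\<forall>e \<in> edges G. f e \<in> \<Omega>) \<and>
     (\<forall>v \<in> vertices G. (\<Sum>e \<in> out_arcs D v. f e) - (\<Sum>e \<in> in_arcs D v. f e) = 0)"

definition p_norm :: "ereal \<Rightarrow> real ^ 'd \<Rightarrow> real" where
  "p_norm p x =
     (if p = \<infinity> then Max (range (\<lambda>i. \<bar>x $ i\<bar>))
      else (\<Sum>i\<in>UNIV. \<bar>x $ i\<bar> powr real_of_ereal p) powr (1 / real_of_ereal p))"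

text \<open>The dimension \<open>d\<close> of an \<open>(r, d, p)\<close>-NZF is \<open>CARD('d)\<close>.\<close>

definition nzf ::
  "real \<Rightarrow> ereal \<Rightarrow> ('v, 'e) mgraph \<Rightarrow> ('v, 'e) pre_digraph \<Rightarrow> ('e \<Rightarrow> real ^ 'd) \<Rightarrow> bool"
where
  "nzf r p G D f \<longleftrightarrow> vector_flow (UNIV - {0}) G D f \<and>
     (\<forall>e \<in> edges G. 1 \<le> p_norm p (f e) \<and> p_norm p (f e) \<le> r - 1)"

text \<open>The infimum is taken in the extended reals, so that it would be \<open>\<infinity>\<close>, and not an
  unspecified real, if no \<open>r\<close> were admissible.\<close>

definition flow_number :: "'d::finite itself \<Rightarrow> ereal \<Rightarrow> ('v, 'e) mgraph \<Rightarrow> ereal" where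
  "flow_number _ p G =
     (INF r \<in> {r :: real. 2 \<le> r \<and> (\<exists>D (f :: 'e \<Rightarrow> real ^ 'd). nzf r p G D f)}. ereal r)"

end

theory Submission
  imports Defs
begin

text \<open>By Seymour's 6-flow theorem a bridgeless graph carries a \<open>\<int>\<^sub>2\<close>-flow and a \<open>\<int>\<^sub>3\<close>-flow with
  no common zero. The first lifts to an integer flow \<open>f\<^sub>0\<close> with values in \<open>{-1, 0, 1}\<close>, the
  second to an integer flow with values in \<open>{-2, \<dots>, 2}\<close>, and the latter is a sum \<open>f\<^sub>1 + f\<^sub>2\<close> of
  flows with values in \<open>{-1, 0, 1}\<close> that never have opposite signs. It remains to find vectors
  \<open>v\<^sub>0, v\<^sub>1, v\<^sub>2\<close> of \<open>\<real>\<^sup>3\<close> such that \<open>f\<^sub>0 v\<^sub>0 + f\<^sub>1 v\<^sub>1 + f\<^sub>2 v\<^sub>2\<close> always has \<open>p\<close>-norm between 1 and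
  \<open>\<surd>2\<close>; for \<open>p = 2\<close>, take an equilateral triangle \<open>v\<^sub>1, v\<^sub>2, -(v\<^sub>1 + v\<^sub>2)\<close> and \<open>v\<^sub>0\<close> orthogonal to it.

  For the 6-flow theorem, a 2-edge cut is removed by contracting one of its edges. In a
  3-edge-connected graph a vertex set \<open>X\<close> is grown together with an even edge set \<open>C\<close> such that
  \<open>\<int>\<^sub>3\<close>-flows on \<open>X\<close> can avoid one prescribed value on every edge outside \<open>C\<close>. A minimal set \<open>W\<close>
  outside \<open>X\<close> with at most one edge to the rest of the complement of \<open>X\<close> is 2-edge-connected and
  has two edges to \<open>X\<close>; two edge-disjoint paths in \<open>W\<close> between their ends enlarge \<open>X\<close>.\<close>

section \<open>Boundaries, cuts and rounding\<close>

text \<open>Net outflow at \<open>v\<close>. As a sum over all of \<open>E\<close> it lets the two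
  contributions of a loop cancel; loops arise by contraction even though the given graph has
  none.\<close>

definition bd :: "('e \<Rightarrow> 'v) \<Rightarrow> ('e \<Rightarrow> 'v) \<Rightarrow> 'e set \<Rightarrow> ('e \<Rightarrow> 'a::ab_group_add) \<Rightarrow> 'v \<Rightarrow> 'a" where
  "bd t h E f v = (\<Sum>e\<in>E. (if t e = v then f e else 0) - (if h e = v then f e else 0))"

definition cut :: "('e \<Rightarrow> 'v) \<Rightarrow> ('e \<Rightarrow> 'v) \<Rightarrow> 'e set \<Rightarrow> 'v set \<Rightarrow> 'e set" where
  "cut t h E S = {e \<in> E. (t e \<in> S) \<noteq> (h e \<in> S)}"

definition inside :: "('e \<Rightarrow> 'v) \<Rightarrow> ('e \<Rightarrow> 'v) \<Rightarrow> 'e set \<Rightarrow> 'v set \<Rightarrow> 'e set" where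
  "inside t h E S = {e \<in> E. t e \<in> S \<and> h e \<in> S}"

lemma bd_add: "bd t h E (\<lambda>e. f e + g e) v = bd t h E f v + bd t h E g v"
  unfolding bd_def sum.distrib[symmetric] by (rule sum.cong) auto

lemma bd_diff: "bd t h E (\<lambda>e. f e - g e) v = bd t h E f v - bd t h E g v"
  unfolding bd_def sum_subtractf[symmetric] by (rule sum.cong) auto

lemma bd_zero [simp]: "bd t h E (\<lambda>_. 0) v = 0"
  by (simp add: bd_def)

lemma bd_mult: "bd t h E (\<lambda>e. c * f e) v = c * bd t h E f v" for c :: "'a::ring"
  unfolding bd_def sum_distrib_left by (rule sum.cong) (auto simp: algebra_simps)

lemma bd_scaleR: "bd t h E (\<lambda>e. f e *\<^sub>R x) v = bd t h E f v *\<^sub>R x"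
  for x :: "'a::real_vector"
  unfolding bd_def scaleR_sum_left by (rule sum.cong) (auto simp: scaleR_left_diff_distrib)

lemma bd_sum: "bd t h E (\<lambda>e. \<Sum>i\<in>I. f i e) v = (\<Sum>i\<in>I. bd t h E (f i) v)"
  by (induction I rule: infinite_finite_induct) (simp_all add: bd_add)

lemma bd_cong: "(\<And>e. e \<in> E \<Longrightarrow> f e = g e) \<Longrightarrow> bd t h E f v = bd t h E g v"
  unfolding bd_def by (rule sum.cong) auto

lemma bd_of_int: "bd t h E (\<lambda>e. of_int (f e)) v = of_int (bd t h E f v)"
  unfolding bd_def of_int_sum by (rule sum.cong) auto

lemma bd_mono_neutral:
  assumes "finite E" "F \<subseteq> E" "\<And>e. e \<in> E - F \<Longrightarrow> f e = 0"
  shows "bd t h E f v = bd t h F f v"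
  unfolding bd_def by (rule sum.mono_neutral_right) (use assms in auto)

lemma bd_single:
  assumes "finite E" "e \<in> E"
  shows "bd t h E (\<lambda>e'. if e' = e then c else 0) v
       = (if t e = v then c else 0) - (if h e = v then c else 0)"
proof -
  have "bd t h E (\<lambda>e'. if e' = e then c else 0) v = bd t h {e} (\<lambda>e'. if e' = e then c else 0) v"
    by (rule bd_mono_neutral) (use assms in auto)
  then show ?thesis by (simp add: bd_def)
qed

lemma bd_eq_0:
  assumes "\<And>e. e \<in> E \<Longrightarrow> t e = v \<or> h e = v \<Longrightarrow> f e = 0"
  shows "bd t h E f v = 0"
  unfolding bd_def by (rule sum.neutral) (use assms in auto)

text \<open>An edge with both ends in \<open>S\<close> is counted once with each sign, so only the
  cut contributes.\<close>

lemma sum_bd: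
  assumes "finite E" "finite S"
  shows "(\<Sum>v\<in>S. bd t h E f v)
       = (\<Sum>e\<in>cut t h E S. if t e \<in> S then f e else - f e)"
proof -
  have "(\<Sum>v\<in>S. bd t h E f v)
      = (\<Sum>e\<in>E. \<Sum>v\<in>S. (if t e = v then f e else 0) - (if h e = v then f e else 0))"
    unfolding bd_def by (rule sum.swap)
  also have "\<dots> = (\<Sum>e\<in>E. (if t e \<in> S then f e else 0) - (if h e \<in> S then f e else 0))"
    using assms(2) by (simp add: sum_subtractf)
  also have "\<dots> = (\<Sum>e\<in>cut t h E S. (if t e \<in> S then f e else 0) - (if h e \<in> S then f e else 0))"
    by (rule sum.mono_neutral_right) (use assms in \<open>auto simp: cut_def\<close>)
  also have "\<dots> = (\<Sum>e\<in>cut t h E S. if t e \<in> S then f e else - f e)"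
    by (rule sum.cong) (auto simp: cut_def)
  finally show ?thesis .
qed

lemma bd_Un_disjoint:
  assumes "finite A" "finite B" "A \<inter> B = {}"
  shows "bd t h (A \<union> B) f v = bd t h A f v + bd t h B f v"
  unfolding bd_def by (rule sum.union_disjoint[OF assms])

section \<open>Contraction of an edge and extension of flows across it\<close>

lemma bd_contract:
  assumes "finite E" "u \<noteq> w"
  defines "\<pi> \<equiv> id(u := w)"
  shows "bd (\<pi> \<circ> t) (\<pi> \<circ> h) E f v =
    (if v = u then 0 else if v = w then bd t h E f u + bd t h E f w else bd t h E f v)"
  unfolding bd_def sum.distrib[symmetric] \<pi>_def
  using assms(2) by (auto intro!: sum.cong sum.neutral)

lemma bd_insert:
  assumes "finite E" "e \<notin> E"
  shows "bd t h (insert e E) f v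
    = (if t e = v then f e else 0) - (if h e = v then f e else 0) + bd t h E f v"
  unfolding bd_def using assms by simp

text \<open>Contraction merges \<open>t e\<close> into \<open>h e\<close>. The value on
  \<open>e\<close> clears the boundary at \<open>t e\<close> and shifts it to \<open>h e\<close>, so
  every vertex has boundary 0 or its boundary in the contracted graph. The predicate
  \<open>P\<close> covers both vanishing and divisibility.\<close>

lemma bd_expand:
  assumes "finite E" "e \<in> E" "t e \<noteq> h e"
    and f: "\<And>v. P (bd ((id(t e := h e)) \<circ> t) ((id(t e := h e)) \<circ> h) (E - {e}) f v)"
    and "P 0"
  defines "g \<equiv> f(e := - bd t h (E - {e}) f (t e))"
  shows "P (bd t h E g v)"
proof -
  define b where "b = bd t h (E - {e}) f"
  have b: "bd t h (E - {e}) g v = b v" for v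
    unfolding b_def by (rule bd_cong) (auto simp: g_def)
  have ge: "g e = - b (t e)" by (simp add: g_def b_def)
  have c: "P (if v = t e then 0 else if v = h e then b (t e) + b (h e) else b v)" for v
    using f[of v] bd_contract[of "E - {e}" "t e" "h e" t h f v] assms(1,3)
    unfolding b_def by simp
  have "bd t h E g v = bd t h (insert e (E - {e})) g v"
    using assms(2) by (simp add: insert_absorb)
  also have "\<dots> = (if t e = v then - b (t e) else 0) - (if h e = v then - b (t e) else 0) + b v"
    using assms(1) by (subst bd_insert) (simp_all add: b ge)
  also have "\<dots> = (if v = t e then 0 else if v = h e then b (t e) + b (h e) else b v)"
    using assms(3) by (auto simp: algebra_simps)
  finally show ?thesis using c[of v] by simp
qed

text \<open>A graph with an edge and no vertex of degree 1 contains a cycle; a loop counts twice in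
  the degree. A loop is itself a circulation. Otherwise an edge \<open>e\<close> is contracted: its
  ends keep degree at least 1 once \<open>e\<close> is removed, so the merged vertex has degree at
  least 2.\<close>

lemma ex_nonzero_circulation:
  fixes t h :: "'e \<Rightarrow> 'v"
  assumes "finite F" "F \<noteq> {}"
    and "\<And>v. card {e \<in> F. t e = v} + card {e \<in> F. h e = v} \<noteq> 1"
  shows "\<exists>k :: 'e \<Rightarrow> real. (\<forall>v. bd t h F k v = 0) \<and> (\<exists>e\<in>F. k e \<noteq> 0)"
  using assms
proof (induction "card F" arbitrary: F t h rule: less_induct)
  case less
  show ?case
  proof (cases "\<exists>e\<in>F. t e = h e")
    case True
    then obtain e where e: "e \<in> F" "t e = h e" by blast
    show ?thesis
      by (rule exI[of _ "\<lambda>e'. if e' = e then 1 else 0"]) (use e less.prems in \<open>auto simp: bd_single\<close>)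
  next
    case False
    obtain e where e: "e \<in> F" using less.prems by blast
    with False have ne: "t e \<noteq> h e" by blast
    define \<pi> where "\<pi> = id(t e := h e)"
    let ?F = "F - {e}"
    have fin: "finite ?F" using less.prems by simp
    have T: "card {x \<in> F. t x = v} = card {x \<in> ?F. t x = v} + (if t e = v then 1 else 0)"
      and H: "card {x \<in> F. h x = v} = card {x \<in> ?F. h x = v} + (if h e = v then 1 else 0)" for v
    proof -
      have "{x \<in> F. t x = v} = (if t e = v then insert e {x \<in> ?F. t x = v} else {x \<in> ?F. t x = v})"
        using e by auto
      then show "card {x \<in> F. t x = v} = card {x \<in> ?F. t x = v} + (if t e = v then 1 else 0)"
        using fin by simp
      have "{x \<in> F. h x = v} = (if h e = v then insert e {x \<in> ?F. h x = v} else {x \<in> ?F. h x = v})"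
        using e by auto
      then show "card {x \<in> F. h x = v} = card {x \<in> ?F. h x = v} + (if h e = v then 1 else 0)"
        using fin by simp
    qed
    let ?d = "\<lambda>v. card {x \<in> ?F. t x = v} + card {x \<in> ?F. h x = v}"
    have du: "?d (t e) \<ge> 1" and dw: "?d (h e) \<ge> 1"
      using less.prems(3)[of "t e"] less.prems(3)[of "h e"] T[of "t e"] H[of "t e"] T[of "h e"] H[of "h e"] ne
      by auto
    have dv: "?d v \<noteq> 1" if "v \<noteq> t e" "v \<noteq> h e" for v
      using less.prems(3)[of v] T[of v] H[of v] that by auto
    have P: "card {x \<in> ?F. (\<pi> \<circ> f) x = v} =
      (if v = t e then 0 else if v = h e then card {x \<in> ?F. f x = t e} + card {x \<in> ?F. f x = h e}
       else card {x \<in> ?F. f x = v})" for f v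
    proof -
      have "{x \<in> ?F. (\<pi> \<circ> f) x = v} = (if v = t e then {} else if v = h e
         then {x \<in> ?F. f x = t e} \<union> {x \<in> ?F. f x = h e} else {x \<in> ?F. f x = v})"
        using ne unfolding \<pi>_def by auto
      moreover have "card ({x \<in> ?F. f x = t e} \<union> {x \<in> ?F. f x = h e})
          = card {x \<in> ?F. f x = t e} + card {x \<in> ?F. f x = h e}"
        by (rule card_Un_disjoint) (use fin ne in auto)
      ultimately show ?thesis by simp
    qed
    have "?F \<noteq> {}"
    proof
      assume "?F = {}"
      then show False using du unfolding \<open>?F = {}\<close> by simp
    qed
    moreover have "card ?F < card F" by (rule card_Diff1_less[OF less.prems(1) e])
    moreover have "card {x \<in> ?F. (\<pi> \<circ> t) x = v} + card {x \<in> ?F. (\<pi> \<circ> h) x = v} \<noteq> 1" for v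
      unfolding P using du dw dv[of v] by auto
    ultimately obtain k :: "'e \<Rightarrow> real" where
      k: "\<And>v. bd (\<pi> \<circ> t) (\<pi> \<circ> h) ?F k v = 0" "\<exists>e\<in>?F. k e \<noteq> 0"
      using less.hyps[of ?F "\<pi> \<circ> t" "\<pi> \<circ> h"] fin by blast
    let ?k = "k(e := - bd t h ?F k (t e))"
    have "bd t h F ?k v = 0" for v
      by (rule bd_expand[where P = "\<lambda>x. x = 0"]) (use less.prems(1) e ne k(1) in \<open>auto simp: \<pi>_def\<close>)
    moreover have "\<exists>e\<in>F. ?k e \<noteq> 0" using k(2) by auto
    ultimately show ?thesis by blast
  qed
qed

text \<open>Total unimodularity of incidence matrices: as long as some value is not an integer, the
  edges with such values carry a circulation, along which one more value becomes an integer.\<close>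

lemma bd_rounding:
  fixes f :: "'e \<Rightarrow> real"
  assumes "finite E" "\<And>v. bd t h E f v \<in> \<int>"
  shows "\<exists>g :: 'e \<Rightarrow> int. (\<forall>v. of_int (bd t h E g v) = bd t h E f v)
    \<and> (\<forall>e\<in>E. \<lfloor>f e\<rfloor> \<le> g e \<and> g e \<le> \<lceil>f e\<rceil>)"
  using assms
proof (induction "card {e \<in> E. f e \<notin> \<int>}" arbitrary: f rule: less_induct)
  case less
  let ?F = "{e \<in> E. f e \<notin> \<int>}"
  have fin: "finite ?F" using less.prems by simp
  show ?case
  proof (cases "?F = {}")
    case True
    then have fl: "of_int \<lfloor>f e\<rfloor> = f e" if "e \<in> E" for e using that by auto
    have "bd t h E (\<lambda>e. of_int \<lfloor>f e\<rfloor>) v = bd t h E f v" for v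
      by (rule bd_cong) (use fl in auto)
    then have "of_int (bd t h E (\<lambda>e. \<lfloor>f e\<rfloor>) v) = bd t h E f v" for v
      by (simp add: bd_of_int)
    then show ?thesis by (intro exI[of _ "\<lambda>e. \<lfloor>f e\<rfloor>"]) (auto)
  next
    case False
    \<comment> \<open>A single nonintegral edge at \<open>v\<close> would make the boundary there
      nonintegral.\<close>
    have deg: "card {e \<in> ?F. t e = v} + card {e \<in> ?F. h e = v} \<noteq> 1" for v
    proof
      assume "card {e \<in> ?F. t e = v} + card {e \<in> ?F. h e = v} = 1"
      then consider "card {e \<in> ?F. t e = v} = 1" "card {e \<in> ?F. h e = v} = 0"
        | "card {e \<in> ?F. t e = v} = 0" "card {e \<in> ?F. h e = v} = 1" by linarith
      then obtain a s where a: "a \<in> ?F" and s: "s = 1 \<or> s = (-1::real)"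
        and S: "\<And>e. e \<in> ?F - {a} \<Longrightarrow> t e \<noteq> v \<and> h e \<noteq> v"
        and A: "(if t a = v then f a else 0) - (if h a = v then f a else 0) = s * f a"
      proof cases
        case 1
        then obtain a where a: "{e \<in> ?F. t e = v} = {a}" by (auto simp: card_1_singleton_iff)
        have b: "{e \<in> ?F. h e = v} = {}" using 1(2) less.prems(1) by (subst (asm) card_0_eq) auto
        show ?thesis by (rule that[of a 1]) (use a b in auto)
      next
        case 2
        then obtain a where a: "{e \<in> ?F. h e = v} = {a}" by (auto simp: card_1_singleton_iff)
        have b: "{e \<in> ?F. t e = v} = {}" using 2(1) less.prems(1) by (subst (asm) card_0_eq) auto
        show ?thesis by (rule that[of a "-1"]) (use a b in auto)
      qed
      have "bd t h E f v = s * f a + bd t h (E - {a}) f v"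
        using bd_insert[of "E - {a}" a t h f v] A a less.prems(1) by (simp add: insert_absorb)
      moreover have "bd t h (E - {a}) f v \<in> \<int>"
        unfolding bd_def using S by (intro Ints_sum Ints_diff) auto
      ultimately have "s * f a \<in> \<int>"
        using less.prems(2)[of v] by (metis Ints_diff add_diff_cancel_right')
      then have "f a \<in> \<int>" using s by auto
      then show False using a by simp
    qed
    obtain k :: "'e \<Rightarrow> real" where k: "\<And>v. bd t h ?F k v = 0" "\<exists>e\<in>?F. k e \<noteq> 0"
      using ex_nonzero_circulation[OF fin False deg] by blast
    define K where "K = {e \<in> ?F. k e \<noteq> 0}"
    have K: "finite K" "K \<noteq> {}" using less.prems(1) k(2) by (auto simp: K_def)
    \<comment> \<open>\<open>l e\<close> is the distance along \<open>k\<close> at which the value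
      on \<open>e\<close> reaches its floor or ceiling. Moving by the least of these,
      \<open>l a\<close>, makes the value on \<open>a\<close> an integer and carries no value past
      one.\<close>
    define l where "l e = (if k e > 0 then (of_int \<lceil>f e\<rceil> - f e) / k e else (f e - of_int \<lfloor>f e\<rfloor>) / (- k e))" for e
    have "l ` K \<noteq> {}" "finite (l ` K)" using K by auto
    then have "Min (l ` K) \<in> l ` K" by (rule Min_in[rotated])
    then obtain a where a: "a \<in> K" "l a = Min (l ` K)" by auto
    have lmin: "l a \<le> l e" if "e \<in> K" for e using that K a by simp
    have lpos: "0 < l e" if "e \<in> K" for e
    proof -
      have ne: "f e \<notin> \<int>" "k e \<noteq> 0" using that by (auto simp: K_def)
      have "of_int \<lfloor>f e\<rfloor> < f e" "f e < of_int \<lceil>f e\<rceil>"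
        using ne by (metis Ints_of_int of_int_floor_le order_le_less,
            metis Ints_of_int le_of_int_ceiling order_le_less)
      then show ?thesis using ne by (auto simp: l_def divide_simps)
    qed
    define k' where "k' e = (if e \<in> ?F then k e else 0)" for e
    have k': "bd t h E k' v = 0" for v
    proof -
      have "bd t h E k' v = bd t h ?F k' v"
        by (rule bd_mono_neutral) (use less.prems in \<open>auto simp: k'_def\<close>)
      also have "\<dots> = bd t h ?F k v" by (rule bd_cong) (auto simp: k'_def)
      finally show ?thesis using k by simp
    qed
    define f' where "f' e = f e + l a * k' e" for e
    have bd': "bd t h E f' v = bd t h E f v" for v
      unfolding f'_def by (simp add: bd_add bd_mult k')
    have rng: "of_int \<lfloor>f e\<rfloor> \<le> f' e \<and> f' e \<le> of_int \<lceil>f e\<rceil>" for e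
    proof (cases "e \<in> K")
      case True
      then have k'e: "k' e = k e" "k e \<noteq> 0" by (auto simp: K_def k'_def)
      note L = lmin[OF True] lpos[OF a(1)]
      show ?thesis
      proof (cases "k e > 0")
        case True
        then have "l a * k e \<le> l e * k e" "l a * k e \<ge> 0" using L by (auto intro: mult_right_mono)
        moreover have "l e * k e = of_int \<lceil>f e\<rceil> - f e" using True by (simp add: l_def)
        ultimately show ?thesis unfolding f'_def k'e by linarith
      next
        case False
        then have neg: "k e < 0" using k'e by simp
        then have "l a * k e \<ge> l e * k e" "l a * k e \<le> 0" using L
          by (auto intro: mult_right_mono_neg mult_nonneg_nonpos)
        moreover have "l e * k e = - (f e - of_int \<lfloor>f e\<rfloor>)" using neg by (simp add: l_def)
        ultimately show ?thesis unfolding f'_def k'e by linarith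
      qed
    next
      case False
      then have "k' e = 0" by (auto simp: K_def k'_def)
      then show ?thesis by (simp add: f'_def)
    qed
    have "f' a \<in> \<int>"
    proof -
      have ka: "k' a = k a" "k a \<noteq> 0" using a by (auto simp: K_def k'_def)
      have "f' a = (if k a > 0 then of_int \<lceil>f a\<rceil> else of_int \<lfloor>f a\<rfloor>)"
        using ka by (simp add: f'_def l_def)
      then show ?thesis by simp
    qed
    moreover have "f' e \<in> \<int>" if "f e \<in> \<int>" for e
      using that by (simp add: f'_def k'_def)
    ultimately have "{e \<in> E. f' e \<notin> \<int>} \<subset> ?F" using a by (auto simp: K_def)
    then have "card {e \<in> E. f' e \<notin> \<int>} < card ?F" using fin by (rule psubset_card_mono[rotated])
    then obtain g :: "'e \<Rightarrow> int" where g: "\<And>v. of_int (bd t h E g v) = bd t h E f v"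
       "\<And>e. e \<in> E \<Longrightarrow> \<lfloor>f' e\<rfloor> \<le> g e \<and> g e \<le> \<lceil>f' e\<rceil>"
      using less.hyps[of f'] less.prems bd' by fastforce
    have "\<lfloor>f e\<rfloor> \<le> \<lfloor>f' e\<rfloor>" "\<lceil>f' e\<rceil> \<le> \<lceil>f e\<rceil>" for e
      using rng[of e] by (auto simp: le_floor_iff ceiling_le_iff)
    then show ?thesis using g by (meson order_trans)
  qed
qed

abbreviation char_fun :: "'e set \<Rightarrow> 'e \<Rightarrow> int" where
  "char_fun C \<equiv> \<lambda>e. of_bool (e \<in> C)"

lemma dvd_bd:
  fixes m :: int
  assumes "\<And>e. e \<in> E \<Longrightarrow> m dvd f e"
  shows "m dvd bd t h E f v"
  unfolding bd_def by (rule dvd_sum) (use assms in auto)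

section \<open>Two edge-disjoint paths\<close>

text \<open>\<open>P\<close> and \<open>N\<close> are the edges that a path may use forwards and backwards.\<close>

definition unit_path ::
  "('e \<Rightarrow> 'v) \<Rightarrow> ('e \<Rightarrow> 'v) \<Rightarrow> 'e set \<Rightarrow> ('e \<Rightarrow> bool) \<Rightarrow> ('e \<Rightarrow> bool) \<Rightarrow> 'v set \<Rightarrow> 'v \<Rightarrow> 'v \<Rightarrow> ('e \<Rightarrow> int) \<Rightarrow> bool"
where
  "unit_path t h E P N S a b k \<longleftrightarrow>
     (\<forall>e. k e \<in> {-1, 0, 1} \<and> (k e \<noteq> 0 \<longrightarrow> e \<in> inside t h E S) \<and> (k e = 1 \<longrightarrow> P e) \<and> (k e = -1 \<longrightarrow> N e)) \<and>
     (\<forall>v. bd t h E k v = of_bool (v = a) - of_bool (v = b))"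

text \<open>Reachability in a residual graph: \<open>S\<close> is a maximal set all of whose
  vertices have a unit path from \<open>a\<close> inside \<open>S\<close>, so no permitted step
  leaves \<open>S\<close>.\<close>

lemma residual_reach:
  fixes t h :: "'e \<Rightarrow> 'v" and P N :: "'e \<Rightarrow> bool"
  assumes "finite E" "finite V" "a \<in> V"
  obtains S where "S \<subseteq> V" "a \<in> S"
    "\<And>e. e \<in> inside t h E V \<Longrightarrow> P e \<Longrightarrow> t e \<in> S \<Longrightarrow> h e \<in> S"
    "\<And>e. e \<in> inside t h E V \<Longrightarrow> N e \<Longrightarrow> h e \<in> S \<Longrightarrow> t e \<in> S"
    "\<And>y. y \<in> S \<Longrightarrow> \<exists>k. unit_path t h E P N S a y k"
proof -
  let ?path = "\<lambda>S. unit_path t h E P N S a"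
  define Q where "Q S \<longleftrightarrow> S \<subseteq> V \<and> a \<in> S \<and> (\<forall>y\<in>S. \<exists>k. ?path S y k)" for S
  have "?path {a} a (\<lambda>_. 0)" by (simp add: unit_path_def)
  then have "Q {a}" using assms(3) by (auto simp: Q_def)
  moreover have "finite {S. Q S}"
    by (rule finite_subset[of _ "Pow V"]) (use assms in \<open>auto simp: Q_def\<close>)
  ultimately obtain S where S: "Q S" and max: "\<And>S'. Q S' \<Longrightarrow> S \<subseteq> S' \<Longrightarrow> S = S'"
    using finite_has_maximal[of "{S. Q S}"] by blast
  have step: "z \<in> S" if e: "e \<in> E" "z \<in> V" "x \<in> S" "s = 1 \<or> s = -1"
    "s = 1 \<Longrightarrow> P e \<and> t e = x \<and> h e = z" "s = -1 \<Longrightarrow> N e \<and> t e = z \<and> h e = x" for e x z and s :: int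
  proof (rule ccontr)
    assume z: "z \<notin> S"
    obtain k where k: "?path S x k" using S e(3) by (auto simp: Q_def)
    define k' where "k' e' = k e' + (if e' = e then s else 0)" for e'
    have e0: "k e = 0" using k z e unfolding unit_path_def inside_def by blast
    have "bd t h E k' v = of_bool (v = a) - of_bool (v = z)" for v
      using k e unfolding k'_def bd_add bd_single[OF assms(1) e(1)] unit_path_def by auto
    moreover have "k' e' \<in> {-1, 0, 1} \<and> (k' e' \<noteq> 0 \<longrightarrow> e' \<in> inside t h E (insert z S)) \<and>
       (k' e' = 1 \<longrightarrow> P e') \<and> (k' e' = -1 \<longrightarrow> N e')" for e'
      using k e e0 unfolding unit_path_def k'_def inside_def by (cases "e' = e") auto
    ultimately have "?path (insert z S) z k'" unfolding unit_path_def by blast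
    moreover have "?path (insert z S) y k" if "?path S y k" for y k
      using that unfolding unit_path_def inside_def by blast
    ultimately have "Q (insert z S)" using S e(2) unfolding Q_def by blast
    then show False using max[of "insert z S"] z by blast
  qed
  show ?thesis
  proof (rule that[of S])
    show "S \<subseteq> V" "a \<in> S" "\<And>y. y \<in> S \<Longrightarrow> \<exists>k. ?path S y k" using S by (auto simp: Q_def)
    fix e assume "e \<in> inside t h E V"
    then have e: "e \<in> E" "t e \<in> V" "h e \<in> V" by (auto simp: inside_def)
    show "h e \<in> S" if "P e" "t e \<in> S" using step[OF e(1) e(3) that(2), of 1] that by simp
    show "t e \<in> S" if "N e" "h e \<in> S" using step[OF e(1) e(2) that(2), of "-1"] that by simp
  qed
qed

text \<open>All cuts of \<open>W\<close> have two edges, so augmenting paths give a flow of two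
  units from \<open>a\<close> to \<open>b\<close> with values in {-1, 0, 1}. Its support is an even
  edge set; \<open>C\<close> is the component of the support at \<open>a\<close>, and
  \<open>W'\<close> its vertex set.\<close>

lemma even_connected_subgraph:
  fixes t h :: "'e \<Rightarrow> 'v"
  assumes "finite E" "finite W" "a \<in> W" "b \<in> W"
    and cuts: "\<And>S. S \<subset> W \<Longrightarrow> S \<noteq> {} \<Longrightarrow> 2 \<le> card (cut t h (inside t h E W) S)"
  shows "\<exists>W' C. W' \<subseteq> W \<and> a \<in> W' \<and> b \<in> W' \<and> C \<subseteq> inside t h E W' \<and>
    (\<forall>v. even (bd t h E (char_fun C) v)) \<and>
    (\<forall>y\<in>W'. \<exists>k :: 'e \<Rightarrow> int. (\<forall>e. e \<notin> C \<longrightarrow> k e = 0) \<and>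
      (\<forall>v. bd t h E k v = of_bool (v = a) - of_bool (v = y)))"
proof -
  let ?I = "inside t h E W"
  note reach = residual_reach[OF assms(1-3)]
  have mono: "inside t h E S \<subseteq> ?I" if "S \<subseteq> W" for S using that by (auto simp: inside_def)
  have finS: "finite S" if "S \<subseteq> W" for S using that assms(2) by (rule finite_subset)

  \<comment> \<open>A path \<open>k1\<close> from \<open>a\<close> to \<open>b\<close>, then an augmenting path \<open>k2\<close> in its residual graph.\<close>
  obtain S1 where S1: "S1 \<subseteq> W" "a \<in> S1"
    "\<And>e. e \<in> ?I \<Longrightarrow> t e \<in> S1 \<Longrightarrow> h e \<in> S1" "\<And>e. e \<in> ?I \<Longrightarrow> h e \<in> S1 \<Longrightarrow> t e \<in> S1"
    and p1: "\<And>y. y \<in> S1 \<Longrightarrow> \<exists>k. unit_path t h E (\<lambda>_. True) (\<lambda>_. True) S1 a y k"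
    by (rule reach[of t h "\<lambda>_. True" "\<lambda>_. True"]) simp_all
  have "cut t h ?I S1 = {}" using S1(3,4) by (auto simp: cut_def)
  then have "S1 = W" using cuts[of S1] S1(1,2) by fastforce
  then obtain k1 :: "'e \<Rightarrow> int" where "unit_path t h E (\<lambda>_. True) (\<lambda>_. True) W a b k1"
    using p1 assms(4) by blast
  then have k1: "\<And>e. k1 e \<in> {-1, 0, 1}" "\<And>e. k1 e \<noteq> 0 \<Longrightarrow> e \<in> ?I"
    "\<And>v. bd t h E k1 v = of_bool (v = a) - of_bool (v = b)"
    unfolding unit_path_def by blast+

  obtain S2 where S2: "S2 \<subseteq> W" "a \<in> S2"
    "\<And>e. e \<in> ?I \<Longrightarrow> k1 e \<le> 0 \<Longrightarrow> t e \<in> S2 \<Longrightarrow> h e \<in> S2"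
    "\<And>e. e \<in> ?I \<Longrightarrow> 0 \<le> k1 e \<Longrightarrow> h e \<in> S2 \<Longrightarrow> t e \<in> S2"
    and p2: "\<And>y. y \<in> S2 \<Longrightarrow> \<exists>k. unit_path t h E (\<lambda>e. k1 e \<le> 0) (\<lambda>e. 0 \<le> k1 e) S2 a y k"
    by (rule reach[of t h "\<lambda>e. k1 e \<le> 0" "\<lambda>e. 0 \<le> k1 e"]) blast
  \<comment> \<open>Otherwise closure under residual steps forces every edge of the cut around
    \<open>S2\<close> to carry one unit of \<open>k1\<close> outwards. The total is 1, so the cut
    would have a single edge.\<close>
  have "b \<in> S2"
  proof (rule ccontr)
    assume b: "b \<notin> S2"
    then have ps: "S2 \<subset> W" "S2 \<noteq> {}" using S2(1,2) assms(4) by auto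
    let ?K = "cut t h ?I S2"
    have "(\<Sum>v\<in>S2. bd t h E k1 v) = (\<Sum>v\<in>S2. of_bool (v = a))"
      by (rule sum.cong) (use k1(3) b in auto)
    also have "\<dots> = 1" using finS[OF S2(1)] S2(2) by simp
    finally have "1 = (\<Sum>e\<in>cut t h E S2. if t e \<in> S2 then k1 e else - k1 e)"
      using sum_bd[OF assms(1) finS[OF S2(1)], of t h k1] by simp
    also have "\<dots> = (\<Sum>e\<in>?K. if t e \<in> S2 then k1 e else - k1 e)"
      by (rule sum.mono_neutral_right)
        (use assms(1) k1(2) in \<open>auto simp: cut_def inside_def\<close>)
    also have "\<dots> = (\<Sum>e\<in>?K. 1)"
    proof (rule sum.cong)
      fix e assume "e \<in> ?K"
      then have e: "e \<in> ?I" "(t e \<in> S2) \<noteq> (h e \<in> S2)" by (auto simp: cut_def)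
      show "(if t e \<in> S2 then k1 e else - k1 e) = 1"
        using S2(3)[OF e(1)] S2(4)[OF e(1)] e(2) k1(1)[of e] by auto
    qed simp
    finally show False using cuts[OF ps] by simp
  qed
  then obtain k2 :: "'e \<Rightarrow> int" where "unit_path t h E (\<lambda>e. k1 e \<le> 0) (\<lambda>e. 0 \<le> k1 e) S2 a b k2"
    using p2 by blast
  then have k2: "\<And>e. k2 e \<in> {-1, 0, 1}" "\<And>e. k2 e \<noteq> 0 \<Longrightarrow> e \<in> inside t h E S2"
    "\<And>e. k2 e = 1 \<Longrightarrow> k1 e \<le> 0" "\<And>e. k2 e = -1 \<Longrightarrow> 0 \<le> k1 e"
    "\<And>v. bd t h E k2 v = of_bool (v = a) - of_bool (v = b)"
    unfolding unit_path_def by blast+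

  \<comment> \<open>By the residual constraints on \<open>k2\<close>, an edge used in both
    directions cancels and none is used twice in the same direction. The boundary of
    \<open>f\<close> is even and \<open>f\<close> agrees modulo 2 with the indicator of its support,
    hence \<open>evD\<close>.\<close>
  define f where "f e = k1 e + k2 e" for e
  have bdf: "bd t h E f v = 2 * (of_bool (v = a) - of_bool (v = b))" for v
    unfolding f_def bd_add k1(3) k2(5) by simp
  have frange: "f e \<in> {-1, 0, 1}" for e
    using k1(1)[of e] k2(1)[of e] k2(3)[of e] k2(4)[of e] by (auto simp: f_def)
  define D where "D = {e. f e \<noteq> 0}"
  have D: "D \<subseteq> ?I"
  proof
    fix e assume "e \<in> D"
    then have "k1 e \<noteq> 0 \<or> k2 e \<noteq> 0" by (auto simp: D_def f_def)
    then show "e \<in> ?I" using k1(2) k2(2) mono[OF S2(1)] by blast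
  qed
  have evD: "even (bd t h E (char_fun D) v)" for v
  proof -
    have "2 dvd bd t h E (\<lambda>e. char_fun D e - f e) v"
      by (rule dvd_bd) (use frange in \<open>force simp: D_def\<close>)
    then show ?thesis by (simp add: bd_diff bdf)
  qed

  \<comment> \<open>The support may contain cycles apart from \<open>a\<close>. Only its component
    at \<open>a\<close> is kept, because \<open>C\<close> has to join every remaining vertex to
    \<open>a\<close>.\<close>
  obtain S where S: "S \<subseteq> W" "a \<in> S"
      "\<And>e. e \<in> ?I \<Longrightarrow> e \<in> D \<Longrightarrow> t e \<in> S \<Longrightarrow> h e \<in> S" "\<And>e. e \<in> ?I \<Longrightarrow> e \<in> D \<Longrightarrow> h e \<in> S \<Longrightarrow> t e \<in> S"
    and p3: "\<And>y. y \<in> S \<Longrightarrow> \<exists>k. unit_path t h E (\<lambda>e. e \<in> D) (\<lambda>e. e \<in> D) S a y k"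
    by (rule reach[of t h "\<lambda>e. e \<in> D" "\<lambda>e. e \<in> D"]) blast
  have SD: "t e \<in> S \<longleftrightarrow> h e \<in> S" if "e \<in> D" for e using S(3,4)[of e] that D by blast
  \<comment> \<open>No edge of \<open>D\<close> leaves \<open>S\<close>, so the two units starting
    at \<open>a\<close> must end inside \<open>S\<close>.\<close>
  have "b \<in> S"
  proof (rule ccontr)
    assume b: "b \<notin> S"
    have "(\<Sum>v\<in>S. bd t h E f v) = (\<Sum>v\<in>S. 2 * of_bool (v = a))"
      by (rule sum.cong) (use bdf b in auto)
    also have "\<dots> = 2" using finS[OF S(1)] S(2) by (simp flip: sum_distrib_left)
    finally have "2 = (\<Sum>e\<in>cut t h E S. if t e \<in> S then f e else - f e)"
      using sum_bd[OF assms(1) finS[OF S(1)], of t h f] by simp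
    also have "\<dots> = 0"
      by (rule sum.neutral) (use SD in \<open>auto simp: cut_def D_def\<close>)
    finally show False by simp
  qed
  define C where "C = D \<inter> inside t h E S"
  have "even (bd t h E (char_fun C) v)" for v
  proof (cases "v \<in> S")
    case True
    have "bd t h E (\<lambda>e. char_fun D e - char_fun C e) v = 0"
      by (rule bd_eq_0) (use True SD in \<open>auto simp: C_def inside_def\<close>)
    then have "bd t h E (char_fun C) v = bd t h E (char_fun D) v" by (simp add: bd_diff)
    then show ?thesis using evD by simp
  next
    case False
    have "bd t h E (char_fun C) v = 0"
      by (rule bd_eq_0) (use False in \<open>auto simp: C_def inside_def\<close>)
    then show ?thesis by simp
  qed
  moreover have "\<exists>k :: 'e \<Rightarrow> int. (\<forall>e. e \<notin> C \<longrightarrow> k e = 0) \<and>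
      (\<forall>v. bd t h E k v = of_bool (v = a) - of_bool (v = y))" if y: "y \<in> S" for y
  proof -
    obtain k where "unit_path t h E (\<lambda>e. e \<in> D) (\<lambda>e. e \<in> D) S a y k"
      using p3[OF y] by blast
    then have k: "\<And>e. k e \<in> {-1, 0, 1}" "\<And>e. k e \<noteq> 0 \<Longrightarrow> e \<in> inside t h E S"
      "\<And>e. k e = 1 \<Longrightarrow> e \<in> D" "\<And>e. k e = -1 \<Longrightarrow> e \<in> D"
      "\<And>v. bd t h E k v = of_bool (v = a) - of_bool (v = y)" unfolding unit_path_def by blast+
    have "k e = 0" if "e \<notin> C" for e using that k(1)[of e] k(2,3,4)[of e] by (auto simp: C_def)
    then show ?thesis using k(5) by blast
  qed
  ultimately show ?thesis using S(1,2) \<open>b \<in> S\<close> by (intro exI[of _ S] exI[of _ C]) (auto simp: C_def)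
qed

section \<open>The 6-flow theorem\<close>

text \<open>Prescribing the boundary \<open>d\<close> and, on each edge outside \<open>C\<close>, a forbidden value \<open>g\<close> makes the
  property strong enough to be preserved when \<open>X\<close> grows.\<close>

definition flexible :: "('e \<Rightarrow> 'v) \<Rightarrow> ('e \<Rightarrow> 'v) \<Rightarrow> 'e set \<Rightarrow> 'v set \<Rightarrow> bool" where
  "flexible t h E X \<longleftrightarrow> (\<exists>C \<subseteq> inside t h E X. (\<forall>v. even (bd t h E (char_fun C) v)) \<and>
     (\<forall>(d :: 'v \<Rightarrow> int) (g :: 'e \<Rightarrow> int). 3 dvd (\<Sum>v\<in>X. d v) \<longrightarrow>
        (\<exists>\<psi> :: 'e \<Rightarrow> int. (\<forall>e. e \<notin> inside t h E X \<longrightarrow> \<psi> e = 0) \<and>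
          (\<forall>v\<in>X. 3 dvd bd t h E \<psi> v - d v) \<and>
          (\<forall>e\<in>inside t h E X - C. \<not> 3 dvd \<psi> e - g e))))"

text \<open>All loops at \<open>x\<close> go into \<open>C\<close>, so no forbidden value remains
  and the zero function serves.\<close>

lemma flexible_singleton: "flexible t h E {x}"
proof -
  let ?I = "inside t h E {x}"
  have "bd t h E (char_fun ?I) v = 0" for v
    unfolding bd_def by (rule sum.neutral) (auto simp: inside_def)
  moreover have "\<exists>\<psi> :: 'a \<Rightarrow> int. (\<forall>e. e \<notin> ?I \<longrightarrow> \<psi> e = 0) \<and>
          (\<forall>v\<in>{x}. 3 dvd bd t h E \<psi> v - d v) \<and> (\<forall>e\<in>?I - ?I. \<not> 3 dvd \<psi> e - g e)"
    if "3 dvd (\<Sum>v\<in>{x}. d v)" for d g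
    by (rule exI[of _ "\<lambda>_. 0"]) (use that in simp)
  ultimately show ?thesis unfolding flexible_def by (intro exI[of _ ?I]) simp
qed

text \<open>With fixed signs, two free choices from {0, 1} have sums covering three consecutive
  integers, hence all residues modulo 3.\<close>

lemma two_signs_mod_3:
  fixes s1 s2 K :: int
  assumes "s1 = 1 \<or> s1 = -1" "s2 = 1 \<or> s2 = -1"
  shows "\<exists>x1 x2. x1 \<in> {0, 1} \<and> x2 \<in> {0, 1} \<and> 3 dvd K - (s1 * x1 + s2 * x2)"
proof -
  have "\<exists>x1 \<in> {0, 1}. \<exists>x2 \<in> {0, 1}. 3 dvd K - (s1 * x1 + s2 * x2)"
    using assms by (elim disjE; simp; presburger)
  then show ?thesis by blast
qed

text \<open>The growth step. Values outside \<open>X\<close> are fixed first, so as to be right on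
  \<open>W\<close>; the boundary they cause on \<open>X\<close> is then absorbed by the flexibility
  of \<open>X\<close>, which accepts any demand with sum 0 modulo 3.\<close>

lemma flexible_join:
  fixes t h :: "'e \<Rightarrow> 'v"
  assumes fin: "finite E" "finite X" "finite W" and disj: "X \<inter> W = {}"
    and X: "flexible t h E X"
    and C: "C \<subseteq> inside t h E W" "\<And>v. even (bd t h E (char_fun C) v)"
    and conn: "\<And>y. y \<in> W \<Longrightarrow> \<exists>k :: 'e \<Rightarrow> int. (\<forall>e. e \<notin> C \<longrightarrow> k e = 0) \<and>
      (\<forall>v. bd t h E k v = of_bool (v = b) - of_bool (v = y))"
    and e: "e1 \<in> E" "e2 \<in> E" "e1 \<noteq> e2"
      "t e1 \<in> W \<and> h e1 \<in> X \<or> t e1 \<in> X \<and> h e1 \<in> W"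
      "t e2 \<in> W \<and> h e2 \<in> X \<or> t e2 \<in> X \<and> h e2 \<in> W"
  shows "flexible t h E (X \<union> W)"
proof -
  let ?I = "inside t h E"
  obtain CX where CX: "CX \<subseteq> ?I X" "\<And>v. even (bd t h E (char_fun CX) v)"
    and gX: "\<And>(d :: 'v \<Rightarrow> int) (g :: 'e \<Rightarrow> int). 3 dvd (\<Sum>v\<in>X. d v) \<Longrightarrow>
        \<exists>\<psi> :: 'e \<Rightarrow> int. (\<forall>e. e \<notin> ?I X \<longrightarrow> \<psi> e = 0) \<and>
          (\<forall>v\<in>X. 3 dvd bd t h E \<psi> v - d v) \<and> (\<forall>e\<in>?I X - CX. \<not> 3 dvd \<psi> e - g e)"
    using X unfolding flexible_def by blast
  obtain k where k: "\<And>y e. y \<in> W \<Longrightarrow> e \<notin> C \<Longrightarrow> k y e = (0::int)"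
    "\<And>y v. y \<in> W \<Longrightarrow> bd t h E (k y) v = of_bool (v = b) - of_bool (v = y)"
    using conn by metis
  have XW: "?I X \<inter> ?I W = {}" using disj by (auto simp: inside_def)
  have IU: "?I X \<subseteq> ?I (X \<union> W)" "?I W \<subseteq> ?I (X \<union> W)" by (auto simp: inside_def)
  have ev: "even (bd t h E (char_fun (CX \<union> C)) v)" for v
  proof -
    have "bd t h E (char_fun (CX \<union> C)) v = bd t h E (\<lambda>e. char_fun CX e + char_fun C e) v"
      by (rule bd_cong) (use XW C(1) CX(1) in auto)
    then show ?thesis using C(2) CX(2) by (simp add: bd_add)
  qed
  have main: "\<exists>\<psi> :: 'e \<Rightarrow> int. (\<forall>e. e \<notin> ?I (X \<union> W) \<longrightarrow> \<psi> e = 0) \<and>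
          (\<forall>v\<in>X \<union> W. 3 dvd bd t h E \<psi> v - d v) \<and> (\<forall>e\<in>?I (X \<union> W) - (CX \<union> C). \<not> 3 dvd \<psi> e - g e)"
    if d: "3 dvd (\<Sum>v\<in>X \<union> W. d v)" for d :: "'v \<Rightarrow> int" and g :: "'e \<Rightarrow> int"
  proof -
    \<comment> \<open>Outside \<open>C\<close> the value \<open>g + 1\<close> is allowed; on \<open>e1\<close> and \<open>e2\<close> so is \<open>g + 2\<close>, and these two choices
      give every possible flow modulo 3 from \<open>X\<close> into \<open>W\<close>. The edges of \<open>C\<close> then correct the
      boundary at the individual vertices of \<open>W\<close>.\<close>
    define M where "M = ?I (X \<union> W) - ?I X - C"
    define a0 where "a0 e = (if e \<in> M then g e + 1 else 0)" for e
    define s where "s e = (if t e \<in> W then 1 else - 1 :: int)" for e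
    have "\<exists>x1 x2. x1 \<in> {0, 1} \<and> x2 \<in> {0, 1} \<and>
      3 dvd ((\<Sum>v\<in>W. d v) - (\<Sum>v\<in>W. bd t h E a0 v)) - (s e1 * x1 + s e2 * x2)"
      by (rule two_signs_mod_3) (auto simp: s_def)
    then obtain x1 x2 where x: "x1 \<in> {0, 1}" "x2 \<in> {0, 1}"
      "3 dvd ((\<Sum>v\<in>W. d v) - (\<Sum>v\<in>W. bd t h E a0 v)) - (s e1 * x1 + s e2 * x2)"
      by blast
    define a where "a e = a0 e + ((if e = e1 then x1 else 0) + (if e = e2 then x2 else 0))" for e
    have eM: "e1 \<in> M" "e2 \<in> M" using e disj C(1) by (auto simp: M_def inside_def)
    have sgl: "(\<Sum>v\<in>W. bd t h E (\<lambda>e'. if e' = e then c else 0) v) = s e * c"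
      if "e \<in> E" "t e \<in> W \<and> h e \<in> X \<or> t e \<in> X \<and> h e \<in> W" for e c
      unfolding bd_single[OF fin(1) that(1)] sum_subtractf
      using that(2) fin(3) disj by (auto simp: s_def)
    have suma: "(\<Sum>v\<in>W. bd t h E a v) = (\<Sum>v\<in>W. bd t h E a0 v) + (s e1 * x1 + s e2 * x2)"
      unfolding a_def bd_add sum.distrib using sgl e by simp
    define r where "r v = d v - bd t h E a v" for v
    have r: "3 dvd (\<Sum>v\<in>W. r v)"
      using x(3) unfolding r_def sum_subtractf suma by (simp add: algebra_simps)
    \<comment> \<open>\<open>k y\<close> sends one unit from \<open>b\<close> to \<open>y\<close>,
      so \<open>c\<close> sends \<open>r y\<close> from each \<open>y\<close> to \<open>b\<close>.
      What arrives at \<open>b\<close> is the sum of all \<open>r y\<close>, which is 0 modulo 3 by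
      the choice of \<open>x1\<close> and \<open>x2\<close>.\<close>
    define c where "c e = - (\<Sum>y\<in>W. r y * k y e)" for e
    have c0: "c e = 0" if "e \<notin> C" for e using that k(1) by (simp add: c_def)
    have bdc: "bd t h E c v = r v - of_bool (v = b) * (\<Sum>y\<in>W. r y)" if "v \<in> W" for v
    proof -
      have "bd t h E c v = - (\<Sum>y\<in>W. r y * bd t h E (k y) v)"
        using bd_diff[of t h E "\<lambda>_. 0" "\<lambda>e. \<Sum>y\<in>W. r y * k y e" v]
        unfolding c_def by (simp add: bd_sum bd_mult)
      also have "\<dots> = - (\<Sum>y\<in>W. r y * (of_bool (v = b) - of_bool (v = y)))"
        using k(2) by simp
      also have "\<dots> = (\<Sum>y\<in>W. r y * of_bool (v = y)) - of_bool (v = b) * (\<Sum>y\<in>W. r y)"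
        by (simp add: right_diff_distrib sum_subtractf sum_distrib_left mult.commute)
      also have "(\<Sum>y\<in>W. r y * of_bool (v = y)) = r v"
        using fin(3) that by (simp add: of_bool_def if_distrib cong: if_cong)
      finally show ?thesis .
    qed
    define f where "f e = a e + c e" for e
    have f0: "f e = 0" if "e \<notin> ?I (X \<union> W)" for e
    proof -
      have "e \<notin> C" "e \<notin> M" "e \<noteq> e1" "e \<noteq> e2" using that C(1) IU eM by (auto simp: M_def)
      then show ?thesis by (simp add: f_def c0 a_def a0_def)
    qed
    have fX0: "f e = 0" if "e \<in> ?I X" for e
    proof -
      have "e \<notin> C" "e \<notin> M" "e \<noteq> e1" "e \<noteq> e2" using that C(1) XW eM by (auto simp: M_def)
      then show ?thesis by (simp add: f_def c0 a_def a0_def)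
    qed
    have fW: "3 dvd bd t h E f v - d v" if "v \<in> W" for v
    proof -
      have "bd t h E f v - d v = - (of_bool (v = b) * (\<Sum>y\<in>W. r y))"
        using bdc[OF that] unfolding f_def bd_add by (simp add: r_def)
      then show ?thesis using r by simp
    qed
    \<comment> \<open>\<open>f\<close> is supported inside \<open>X \<union> W\<close>, so its
      boundaries cancel in total and the demand left for \<open>X\<close> has sum 0 modulo 3, as
      flexibility requires.\<close>
    have "(\<Sum>v\<in>X \<union> W. bd t h E f v) = 0"
      unfolding sum_bd[OF fin(1) finite_UnI[OF fin(2,3)]]
      by (rule sum.neutral) (use f0 in \<open>auto simp: cut_def inside_def\<close>)
    then have "(\<Sum>v\<in>X. bd t h E f v) = - (\<Sum>v\<in>W. bd t h E f v)"
      using sum.union_disjoint[OF fin(2,3) disj, of "bd t h E f"] by simp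
    moreover have "3 dvd (\<Sum>v\<in>W. bd t h E f v - d v)" using fW by (rule dvd_sum)
    moreover note d[unfolded sum.union_disjoint[OF fin(2,3) disj]]
    ultimately have "3 dvd (\<Sum>v\<in>X. d v - bd t h E f v)"
      unfolding sum_subtractf by presburger
    then obtain \<psi> :: "'e \<Rightarrow> int" where \<psi>: "\<And>e. e \<notin> ?I X \<Longrightarrow> \<psi> e = 0"
      "\<And>v. v \<in> X \<Longrightarrow> 3 dvd bd t h E \<psi> v - (d v - bd t h E f v)"
      "\<And>e. e \<in> ?I X - CX \<Longrightarrow> \<not> 3 dvd \<psi> e - g e"
      using gX[of "\<lambda>v. d v - bd t h E f v" g] by blast
    have "f e + \<psi> e = 0" if "e \<notin> ?I (X \<union> W)" for e
      using f0[OF that] \<psi>(1)[of e] IU that by auto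
    moreover have "3 dvd bd t h E (\<lambda>e. f e + \<psi> e) v - d v" if "v \<in> X \<union> W" for v
    proof (cases "v \<in> X")
      case True
      then show ?thesis using \<psi>(2)[OF True] unfolding bd_add by (simp add: algebra_simps)
    next
      case False
      then have "v \<in> W" using that by simp
      moreover have "bd t h E \<psi> v = 0"
        by (rule bd_eq_0, rule \<psi>(1)) (use False in \<open>auto simp: inside_def\<close>)
      ultimately show ?thesis using fW by (simp add: bd_add)
    qed
    moreover have "\<not> 3 dvd f e + \<psi> e - g e" if "e \<in> ?I (X \<union> W) - (CX \<union> C)" for e
    proof (cases "e \<in> ?I X")
      case True
      then show ?thesis using \<psi>(3)[of e] fX0[of e] that by simp
    next
      case False
      then have "e \<in> M" "e \<notin> C" using that by (auto simp: M_def)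
      then have "f e + \<psi> e - g e = 1 + ((if e = e1 then x1 else 0) + (if e = e2 then x2 else 0))"
        using \<psi>(1)[OF False] by (simp add: f_def c0 a_def a0_def)
      \<comment> \<open>As \<open>e1\<close> and \<open>e2\<close> differ, at most one of
        \<open>x1\<close> and \<open>x2\<close> is added.\<close>
      then have "f e + \<psi> e - g e = 1 \<or> f e + \<psi> e - g e = 2" using x(1,2) e(3) by auto
      then show ?thesis by auto
    qed
    ultimately show ?thesis by (intro exI[of _ "\<lambda>e. f e + \<psi> e"]) blast
  qed
  show ?thesis unfolding flexible_def
    by (rule exI[of _ "CX \<union> C"]) (use ev main CX(1) C(1) IU in blast)
qed

lemma flexible_if_3_edge_connected:
  fixes t h :: "'e \<Rightarrow> 'v"
  assumes fin: "finite E" "finite V" and "V \<noteq> {}"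
    and cuts: "\<And>S. S \<subset> V \<Longrightarrow> S \<noteq> {} \<Longrightarrow> 3 \<le> card (cut t h E S)"
    and ends: "\<And>e. e \<in> E \<Longrightarrow> t e \<in> V \<and> h e \<in> V"
  shows "flexible t h E V"
proof -
  let ?I = "inside t h E"
  define Q where "Q = {X. X \<subseteq> V \<and> X \<noteq> {} \<and> flexible t h E X}"
  obtain x where "x \<in> V" using \<open>V \<noteq> {}\<close> by blast
  then have "{x} \<in> Q" by (simp add: flexible_singleton Q_def)
  moreover have "finite Q" by (rule finite_subset[of _ "Pow V"]) (use fin in \<open>auto simp: Q_def\<close>)
  ultimately obtain X where "X \<in> Q" and max: "\<And>X'. X' \<in> Q \<Longrightarrow> X \<subseteq> X' \<Longrightarrow> X = X'"
    using finite_has_maximal[of Q] by blast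
  then have X: "X \<subseteq> V" "X \<noteq> {}" "flexible t h E X" by (auto simp: Q_def)
  have "X = V"
  proof (rule ccontr)
    assume "X \<noteq> V"
    let ?R = "?I (V - X)"
    define P where "P = {W. W \<subseteq> V - X \<and> W \<noteq> {} \<and> card (cut t h ?R W) \<le> 1}"
    have finc: "finite (cut t h A S)" if "A \<subseteq> E" for A S
      by (rule finite_subset[OF _ fin(1)]) (use that in \<open>auto simp: cut_def\<close>)
    have IE: "?I A \<subseteq> E" for A by (auto simp: inside_def)
    have "cut t h ?R (V - X) = {}" by (auto simp: cut_def inside_def)
    then have "V - X \<in> P" using X(1) \<open>X \<noteq> V\<close> by (auto simp: P_def)
    moreover have "finite P" by (rule finite_subset[of _ "Pow V"]) (use fin in \<open>auto simp: P_def\<close>)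
    ultimately obtain W where "W \<in> P" and min: "\<And>W'. W' \<in> P \<Longrightarrow> W' \<subseteq> W \<Longrightarrow> W = W'"
      using finite_has_minimal[of P] by blast
    then have W: "W \<subseteq> V - X" "W \<noteq> {}" "card (cut t h ?R W) \<le> 1" by (auto simp: P_def)
    define B where "B = {e \<in> E. t e \<in> W \<and> h e \<in> X \<or> t e \<in> X \<and> h e \<in> W}"
    have finB: "finite B" using fin(1) by (simp add: B_def)
    \<comment> \<open>At least three edges leave \<open>W\<close> and at most one of them avoids
      \<open>X\<close>, so two reach \<open>X\<close>.\<close>
    have "3 \<le> card (cut t h E W)" by (rule cuts) (use W X in blast)+
    also have "\<dots> \<le> card (cut t h ?R W \<union> B)"
    proof (rule card_mono)
      show "finite (cut t h ?R W \<union> B)" using finc[OF IE] finB by simp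
      show "cut t h E W \<subseteq> cut t h ?R W \<union> B"
        using ends W(1) by (auto simp: cut_def inside_def B_def)
    qed
    also have "\<dots> \<le> 1 + card B" using card_Un_le[of "cut t h ?R W" B] W(3) by linarith
    finally have "2 \<le> card B" by simp
    then obtain e1 e2 where e: "e1 \<in> B" "e2 \<in> B" "e1 \<noteq> e2"
      by (metis card_2_iff' obtain_subset_with_card_n subsetD)
    define b where "b e = (if t e \<in> W then t e else h e)" for e
    have b: "b e1 \<in> W" "b e2 \<in> W" using e by (auto simp: B_def b_def)
    \<comment> \<open>\<open>S\<close> and \<open>W - S\<close> have the same cut inside
      \<open>W\<close>. An edge from \<open>W\<close> to the rest of \<open>V - X\<close>, of which
      there is at most one, starts in only one of the two; for the other, the whole cut in
      \<open>V - X\<close> lies inside \<open>W\<close> and has two edges because \<open>W\<close>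
      is minimal in \<open>P\<close>.\<close>
    have two: "2 \<le> card (cut t h (?I W) S)" if S: "S \<subset> W" "S \<noteq> {}" for S
    proof -
      let ?d = "\<lambda>T. cut t h ?R T \<inter> cut t h ?R W"
      have sub: "cut t h ?R T \<subseteq> cut t h (?I W) T \<union> ?d T" if "T \<subseteq> W" for T
        using that W(1) by (auto simp: cut_def inside_def)
      have big: "2 \<le> card (cut t h ?R T)" if "T \<subset> W" "T \<noteq> {}" for T
      proof (rule ccontr)
        assume "\<not> 2 \<le> card (cut t h ?R T)"
        then have "T \<in> P" using that W(1) by (auto simp: P_def)
        then show False using min[of T] that by blast
      qed
      have c: "2 \<le> card (cut t h (?I W) T)" if "T \<subset> W" "T \<noteq> {}" "?d T = {}" for T
      proof -
        have "2 \<le> card (cut t h ?R T)" by (rule big[OF that(1,2)])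
        also have "\<dots> \<le> card (cut t h (?I W) T)"
          by (rule card_mono) (use finc[OF IE] sub[of T] that in auto)
        finally show ?thesis .
      qed
      have "?d S = {} \<or> ?d (W - S) = {}"
      proof (rule ccontr)
        assume "\<not> ?thesis"
        then obtain x y where xy: "x \<in> ?d S" "y \<in> ?d (W - S)" by blast
        then have "x \<noteq> y" using S(1) by (auto simp: cut_def inside_def)
        then have "card {x, y} = 2" by simp
        moreover have "card {x, y} \<le> card (cut t h ?R W)"
          by (rule card_mono) (use finc[OF IE] xy in auto)
        ultimately show False using W(3) by simp
      qed
      moreover have "cut t h (?I W) (W - S) = cut t h (?I W) S"
        using S(1) by (auto simp: cut_def inside_def)
      ultimately show ?thesis using c[of S] c[of "W - S"] S by auto
    qed
    have finW: "finite W" by (rule finite_subset[OF _ fin(2)]) (use W in blast)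
    obtain W' C where W': "W' \<subseteq> W" "b e1 \<in> W'" "b e2 \<in> W'" "C \<subseteq> ?I W'"
      "\<And>v. even (bd t h E (char_fun C) v)"
      "\<And>y. y \<in> W' \<Longrightarrow> \<exists>k :: 'e \<Rightarrow> int. (\<forall>e. e \<notin> C \<longrightarrow> k e = 0) \<and>
        (\<forall>v. bd t h E k v = of_bool (v = b e1) - of_bool (v = y))"
      using even_connected_subgraph[OF fin(1) finW b two] by blast
    have "flexible t h E (X \<union> W')"
    proof (rule flexible_join[OF fin(1) _ _ _ X(3) W'(4-6)])
      show "finite X" "finite W'" using X(1) W'(1) fin(2) finW by (auto intro: finite_subset)
      show "X \<inter> W' = {}" using W(1) W'(1) by blast
      show "e1 \<in> E" "e2 \<in> E" "e1 \<noteq> e2" using e by (auto simp: B_def)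
      show "t e1 \<in> W' \<and> h e1 \<in> X \<or> t e1 \<in> X \<and> h e1 \<in> W'"
        "t e2 \<in> W' \<and> h e2 \<in> X \<or> t e2 \<in> X \<and> h e2 \<in> W'"
        using e W'(2,3) W(1) by (auto simp: B_def b_def split: if_splits)
    qed
    then have "X \<union> W' \<in> Q" using X(1,2) W(1) W'(1) by (auto simp: Q_def)
    then have "X = X \<union> W'" using max[of "X \<union> W'"] by blast
    then show False using W'(1,2) W(1) by blast
  qed
  then show ?thesis using X by simp
qed

text \<open>Induction on the number of edges. A disconnected graph is split, and a 2-edge cut loses
  an edge by contraction; either way the cuts of the smaller graphs are cuts of the old one, so none
  of size 1 appears. Otherwise all relevant cuts have at least three edges.\<close>

lemma modular_six_flow:
  fixes t h :: "'e \<Rightarrow> 'v"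
  assumes "finite E" "\<And>S. card (cut t h E S) \<noteq> 1"
  shows "\<exists>(\<phi> :: 'e \<Rightarrow> int) (\<psi> :: 'e \<Rightarrow> int). (\<forall>v. 2 dvd bd t h E \<phi> v) \<and> (\<forall>v. 3 dvd bd t h E \<psi> v) \<and>
    (\<forall>e\<in>E. \<not> (2 dvd \<phi> e \<and> 3 dvd \<psi> e))"
  using assms
proof (induction "card E" arbitrary: E t h rule: less_induct)
  case less
  let ?I = "inside t h E"
  note finE = less.prems(1)
  consider
    (split) S where "cut t h E S = {}" "?I S \<noteq> {}" "?I (- S) \<noteq> {}"
    | (two) S where "card (cut t h E S) = 2"
    | (three) "\<And>S. card (cut t h E S) \<noteq> 2"
      "\<And>S. cut t h E S = {} \<Longrightarrow> ?I S = {} \<or> ?I (- S) = {}"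
    by metis
  then show ?case
  proof cases
    case split
    let ?A = "?I S" and ?B = "?I (- S)"
    have E: "E = ?A \<union> ?B" and AB: "?A \<inter> ?B = {}"
      using split(1) by (auto simp: cut_def inside_def)
    have fin: "finite ?A" "finite ?B" using finE by (auto simp: inside_def)
    have cA: "cut t h ?A T = cut t h E (T \<inter> S)" for T
      using split(1) by (auto simp: cut_def inside_def)
    have cB: "cut t h ?B T = cut t h E (T - S)" for T
      using split(1) by (auto simp: cut_def inside_def)
    have "?A \<subset> E" "?B \<subset> E" using E AB split(2,3) by blast+
    then have "card ?A < card E" "card ?B < card E" using finE by (auto intro: psubset_card_mono)
    note IH = less.hyps[OF this(1) fin(1)] less.hyps[OF this(2) fin(2)]
    obtain \<phi>1 \<psi>1 :: "'e \<Rightarrow> int" where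
      1: "\<And>v. 2 dvd bd t h ?A \<phi>1 v" "\<And>v. 3 dvd bd t h ?A \<psi>1 v"
        "\<And>e. e \<in> ?A \<Longrightarrow> \<not> (2 dvd \<phi>1 e \<and> 3 dvd \<psi>1 e)"
      using IH(1)[of t h, unfolded cA, OF less.prems(2)] by blast
    obtain \<phi>2 \<psi>2 :: "'e \<Rightarrow> int" where
      2: "\<And>v. 2 dvd bd t h ?B \<phi>2 v" "\<And>v. 3 dvd bd t h ?B \<psi>2 v"
        "\<And>e. e \<in> ?B \<Longrightarrow> \<not> (2 dvd \<phi>2 e \<and> 3 dvd \<psi>2 e)"
      using IH(2)[of t h, unfolded cB, OF less.prems(2)] by blast
    have glue: "m dvd bd t h E (\<lambda>e. if e \<in> ?A then f e else g e) v"
      if "m dvd bd t h ?A f v" "m dvd bd t h ?B g v" for f g :: "'e \<Rightarrow> int" and m v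
    proof -
      let ?f = "\<lambda>e. if e \<in> ?A then f e else g e"
      have "bd t h E ?f v = bd t h ?A ?f v + bd t h ?B ?f v"
        using bd_Un_disjoint[OF fin AB, of t h ?f v] E by simp
      moreover have "bd t h ?A ?f v = bd t h ?A f v" by (rule bd_cong) simp
      moreover have "bd t h ?B ?f v = bd t h ?B g v" by (rule bd_cong) (use AB in auto)
      ultimately show ?thesis using that by simp
    qed
    show ?thesis
      by (rule exI[of _ "\<lambda>e. if e \<in> ?A then \<phi>1 e else \<phi>2 e"],
          rule exI[of _ "\<lambda>e. if e \<in> ?A then \<psi>1 e else \<psi>2 e"],
          intro conjI allI ballI glue 1(1,2) 2(1,2)) (use 1(3) 2(3) E in auto)
  next
    case two
    then obtain e f where ef: "cut t h E S = {e, f}" "e \<noteq> f" by (auto simp: card_2_iff)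
    then have "e \<in> cut t h E S" "f \<in> cut t h E S" by simp_all
    then have e: "e \<in> E" "t e \<noteq> h e" and f: "f \<in> E" unfolding cut_def by auto
    define \<pi> where "\<pi> = id(t e := h e)"
    let ?F = "E - {e}"
    have "\<pi> (t e) = \<pi> (h e)" by (simp add: \<pi>_def)
    then have c: "cut (\<pi> \<circ> t) (\<pi> \<circ> h) ?F T = cut t h E (\<pi> -` T)" for T
      by (auto simp: cut_def)
    have "finite ?F" using finE by simp
    from less.hyps[OF card_Diff1_less[OF finE e(1)] this, of "\<pi> \<circ> t" "\<pi> \<circ> h", unfolded c, OF less.prems(2)]
    obtain \<phi> \<psi> :: "'e \<Rightarrow> int" where
      IH: "\<And>v. 2 dvd bd (\<pi> \<circ> t) (\<pi> \<circ> h) ?F \<phi> v" "\<And>v. 3 dvd bd (\<pi> \<circ> t) (\<pi> \<circ> h) ?F \<psi> v"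
        "\<And>e'. e' \<in> ?F \<Longrightarrow> \<not> (2 dvd \<phi> e' \<and> 3 dvd \<psi> e')"
      by blast
    let ?\<phi> = "\<phi>(e := - bd t h ?F \<phi> (t e))" and ?\<psi> = "\<psi>(e := - bd t h ?F \<psi> (t e))"
    have b2: "2 dvd bd t h E ?\<phi> v" for v
      by (rule bd_expand[where P = "\<lambda>x. 2 dvd x"])
        (use finE e IH(1)[unfolded \<pi>_def] in simp_all)
    have b3: "3 dvd bd t h E ?\<psi> v" for v
      by (rule bd_expand[where P = "\<lambda>x. 3 dvd x"])
        (use finE e IH(2)[unfolded \<pi>_def] in simp_all)
    \<comment> \<open>The cut consists of \<open>e\<close> and \<open>f\<close>, so their values
      agree up to sign modulo \<open>m\<close>. Thus \<open>e\<close> inherits from \<open>f\<close>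
      that it is not zero modulo both 2 and 3. Intersecting with the ends of edges replaces
      \<open>S\<close>, possibly infinite, by a finite set with the same cut.\<close>
    have iff: "m dvd g e \<longleftrightarrow> m dvd g f" if "\<And>v. m dvd bd t h E g v" for m and g :: "'e \<Rightarrow> int"
    proof -
      let ?T = "S \<inter> (t ` E \<union> h ` E)"
      have "m dvd (\<Sum>v\<in>?T. bd t h E g v)" by (rule dvd_sum) (rule that)
      moreover have "cut t h E ?T = {e, f}" using ef(1) by (auto simp: cut_def)
      ultimately have "m dvd (if t e \<in> ?T then g e else - g e) + (if t f \<in> ?T then g f else - g f)"
        using sum_bd[OF finE, of ?T t h g] finE ef(2) by simp
      moreover have "m dvd (if b then x else - x) + (if c then y else - y) \<Longrightarrow> m dvd x \<longleftrightarrow> m dvd y"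
        for b c and x y :: int
        using dvd_add_right_iff[of m "if b then x else - x" "if c then y else - y"]
          dvd_add_left_iff[of m "if c then y else - y" "if b then x else - x"]
        by (auto split: if_splits)
      ultimately show ?thesis by blast
    qed
    have "\<not> (2 dvd ?\<phi> e' \<and> 3 dvd ?\<psi> e')" if "e' \<in> E" for e'
    proof (cases "e' = e")
      case True
      have "\<not> (2 dvd ?\<phi> f \<and> 3 dvd ?\<psi> f)" using IH(3)[of f] f ef(2) by simp
      then show ?thesis unfolding True using iff[of 2 ?\<phi>, OF b2] iff[of 3 ?\<psi>, OF b3] by blast
    next
      case False
      then show ?thesis using IH(3)[of e'] that by simp
    qed
    then show ?thesis using b2 b3 by blast
  next
    case three
    show ?thesis
    proof (cases "E = {}")
      case True
      then show ?thesis by (simp add: bd_def)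
    next
      case False
      \<comment> \<open>Isolated vertices are left out, as they would give empty cuts.\<close>
      define V where "V = t ` E \<union> h ` E"
      have "flexible t h E V"
      proof (rule flexible_if_3_edge_connected[OF finE])
        show "finite V" "V \<noteq> {}" using finE False by (auto simp: V_def)
        show "t e \<in> V \<and> h e \<in> V" if "e \<in> E" for e using that by (auto simp: V_def)
        fix S assume S: "S \<subset> V" "S \<noteq> {}"
        have "cut t h E S \<noteq> {}"
        proof
          assume c: "cut t h E S = {}"
          then have "?I S \<noteq> {}" "?I (- S) \<noteq> {}" using S unfolding V_def cut_def inside_def by auto
          then show False using three(2)[OF c] by blast
        qed
        then have "card (cut t h E S) \<noteq> 0" using finE by (simp add: cut_def)
        then show "3 \<le> card (cut t h E S)"
          using three(1)[of S] less.prems(2)[of S] by linarith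
      qed
      moreover have IV: "?I V = E" by (auto simp: inside_def V_def)
      ultimately obtain C where C: "\<And>v. even (bd t h E (char_fun C) v)"
        and solve: "\<And>(d :: 'v \<Rightarrow> int) (g :: 'e \<Rightarrow> int). 3 dvd (\<Sum>v\<in>V. d v) \<Longrightarrow>
          \<exists>\<psi> :: 'e \<Rightarrow> int. (\<forall>e. e \<notin> E \<longrightarrow> \<psi> e = 0) \<and>
            (\<forall>v\<in>V. 3 dvd bd t h E \<psi> v - d v) \<and> (\<forall>e\<in>E - C. \<not> 3 dvd \<psi> e - g e)"
        unfolding flexible_def IV by (elim exE conjE) (rule that, auto)
      \<comment> \<open>With demand 0 and forbidden value 0, \<open>\<psi>\<close> can vanish modulo
        3 only on \<open>C\<close>, where \<open>char_fun C\<close> is odd.\<close>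
      obtain \<psi> :: "'e \<Rightarrow> int" where \<psi>: "\<And>v. v \<in> V \<Longrightarrow> 3 dvd bd t h E \<psi> v"
          "\<And>e. e \<in> E - C \<Longrightarrow> \<not> 3 dvd \<psi> e"
        using solve[of "\<lambda>_. 0" "\<lambda>_. 0"] by auto
      have "3 dvd bd t h E \<psi> v" for v
      proof (cases "v \<in> V")
        case False
        then have "bd t h E \<psi> v = 0" by (intro bd_eq_0) (auto simp: V_def)
        then show ?thesis by simp
      qed (rule \<psi>(1))
      then show ?thesis using C \<psi>(2) by (intro exI[of _ "char_fun C"] exI[of _ \<psi>]) auto
    qed
  qed
qed

section \<open>From modular flows to integer flows\<close>

lemma integer_six_flow:
  fixes t h :: "'e \<Rightarrow> 'v"
  assumes fin: "finite E" and "\<And>S. card (cut t h E S) \<noteq> 1"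
  shows "\<exists>(f0 :: 'e \<Rightarrow> int) (f1 :: 'e \<Rightarrow> int) (f2 :: 'e \<Rightarrow> int). (\<forall>v. bd t h E f0 v = 0 \<and> bd t h E f1 v = 0 \<and> bd t h E f2 v = 0) \<and>
    (\<forall>e\<in>E. f0 e \<in> {-1, 0, 1} \<and> f1 e \<in> {-1, 0, 1} \<and> f2 e \<in> {-1, 0, 1} \<and> f1 e * f2 e \<noteq> -1 \<and>
      (f0 e \<noteq> 0 \<or> f1 e \<noteq> 0 \<or> f2 e \<noteq> 0))"
proof -
  obtain \<phi> \<psi> :: "'e \<Rightarrow> int" where \<phi>: "\<And>v. 2 dvd bd t h E \<phi> v" and \<psi>: "\<And>v. 3 dvd bd t h E \<psi> v"
    and nz: "\<And>e. e \<in> E \<Longrightarrow> \<not> (2 dvd \<phi> e \<and> 3 dvd \<psi> e)"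
    using modular_six_flow[OF assms] by blast
  \<comment> \<open>\<open>f\<close> divided by \<open>m\<close> has integral boundary. Subtracting
    \<open>m\<close> times a rounding of it from \<open>f\<close> removes the boundary and leaves a
    remainder below \<open>m\<close> in absolute value.\<close>
  have lift: "\<exists>g :: 'e \<Rightarrow> int. (\<forall>v. bd t h E g v = 0) \<and> (\<forall>e\<in>E. \<bar>g e\<bar> < m \<and> m dvd g e - f e)"
    if m: "m > 0" and f: "\<And>v. m dvd bd t h E f v" for f :: "'e \<Rightarrow> int" and m :: int
  proof -
    let ?q = "\<lambda>e. of_int (f e) / of_int m :: real"
    have q: "of_int m * bd t h E ?q v = of_int (bd t h E f v)" for v
      using m by (simp flip: bd_mult bd_of_int)
    have "bd t h E ?q v \<in> \<int>" for v
    proof -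
      obtain j where "bd t h E f v = m * j" using f by blast
      then have "bd t h E ?q v = of_int j" using q[of v] m by simp
      then show ?thesis by simp
    qed
    from bd_rounding[OF fin this] obtain x :: "'e \<Rightarrow> int" where
      x: "\<And>v. of_int (bd t h E x v) = bd t h E ?q v" "\<And>e. e \<in> E \<Longrightarrow> \<lfloor>?q e\<rfloor> \<le> x e \<and> x e \<le> \<lceil>?q e\<rceil>"
      by blast
    have "bd t h E (\<lambda>e. f e - m * x e) v = 0" for v
    proof -
      have "real_of_int (m * bd t h E x v) = of_int (bd t h E f v)" using q[of v] x(1)[of v] by simp
      then show ?thesis unfolding bd_diff bd_mult by linarith
    qed
    moreover have "\<bar>f e - m * x e\<bar> < m" if "e \<in> E" for e
    proof -
      have "of_int (x e) < ?q e + 1" "?q e < of_int (x e) + 1" using x(2)[OF that] by linarith+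
      then have "of_int (m * x e) < real_of_int (f e + m)" "real_of_int (f e) < of_int (m * x e + m)"
        using m by (simp_all add: field_simps)
      then show ?thesis by linarith
    qed
    ultimately show ?thesis by (intro exI[of _ "\<lambda>e. f e - m * x e"]) auto
  qed
  obtain f0 :: "'e \<Rightarrow> int" where f0: "\<And>v. bd t h E f0 v = 0"
    "\<And>e. e \<in> E \<Longrightarrow> \<bar>f0 e\<bar> < 2 \<and> 2 dvd f0 e - \<phi> e" using lift[of 2 \<phi>] \<phi> by auto
  obtain g :: "'e \<Rightarrow> int" where g: "\<And>v. bd t h E g v = 0"
    "\<And>e. e \<in> E \<Longrightarrow> \<bar>g e\<bar> < 3 \<and> 3 dvd g e - \<psi> e" using lift[of 3 \<psi>] \<psi> by auto
  \<comment> \<open>Rounding half of \<open>g\<close> splits 2 as 1 + 1, 1 as 1 + 0 or 0 + 1, 0 as 0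
    + 0, and likewise for negative values, so the two parts never have opposite signs.\<close>
  let ?q = "\<lambda>e. (1/2) * of_int (g e) :: real"
  have "bd t h E ?q v = 0" for v unfolding bd_mult bd_of_int using g(1) by simp
  then have "bd t h E ?q v \<in> \<int>" for v by simp
  from bd_rounding[OF fin this] obtain f1 :: "'e \<Rightarrow> int" where
    f1: "\<And>v. of_int (bd t h E f1 v) = bd t h E ?q v" "\<And>e. e \<in> E \<Longrightarrow> \<lfloor>?q e\<rfloor> \<le> f1 e \<and> f1 e \<le> \<lceil>?q e\<rceil>"
    by blast
  define f2 where "f2 e = g e - f1 e" for e
  have "bd t h E f1 v = 0" for v using f1(1)[of v] \<open>bd t h E ?q v = 0\<close> by simp
  moreover from this have "bd t h E f2 v = 0" for v unfolding f2_def bd_diff using g(1) by simp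
  moreover have "f0 e \<in> {-1, 0, 1} \<and> f1 e \<in> {-1, 0, 1} \<and> f2 e \<in> {-1, 0, 1} \<and> f1 e * f2 e \<noteq> -1 \<and>
      (f0 e \<noteq> 0 \<or> f1 e \<noteq> 0 \<or> f2 e \<noteq> 0)" if e: "e \<in> E" for e
  proof -
    have "g e \<in> {-2, -1, 0, 1, 2}" using g(2)[OF e] by auto
    moreover have "f0 e \<in> {-1, 0, 1}" using f0(2)[OF e] by auto
    moreover have "f0 e \<noteq> 0 \<or> g e \<noteq> 0"
      using f0(2)[OF e] g(2)[OF e] nz[OF e] by auto
    moreover have "2 * f1 e \<le> g e + 1" "g e - 1 \<le> 2 * f1 e" using f1(2)[OF e] by linarith+
    moreover from this have "f1 e \<in> {-1, 0, 1}" using g(2)[OF e] by auto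
    ultimately show ?thesis unfolding f2_def by auto
  qed
  ultimately show ?thesis using f0(1)
    by (intro exI[of _ f0] exI[of _ f1] exI[of _ f2]) blast
qed

section \<open>The three vectors\<close>

lemma p_norm_real_bounds:
  assumes q: "1 \<le> q" and "1 \<le> \<bar>x\<bar> powr q + \<bar>y\<bar> powr q + \<bar>z\<bar> powr q"
    and "\<bar>x\<bar> powr q + \<bar>y\<bar> powr q + \<bar>z\<bar> powr q \<le> 2 powr (q / 2)"
  shows "1 \<le> p_norm (ereal q) (vector [x, y, z] :: real ^ 3) \<and>
    p_norm (ereal q) (vector [x, y, z] :: real ^ 3) \<le> sqrt 2"
proof -
  let ?s = "\<bar>x\<bar> powr q + \<bar>y\<bar> powr q + \<bar>z\<bar> powr q"
  have n: "p_norm (ereal q) (vector [x, y, z] :: real ^ 3) = ?s powr (1 / q)"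
    by (simp add: p_norm_def sum_3)
  have "1 \<le> ?s powr (1 / q)" using q assms(2) by (intro ge_one_powr_ge_zero) auto
  moreover have "?s powr (1 / q) \<le> (2 powr (q / 2)) powr (1 / q)"
    by (rule powr_mono2) (use q assms in auto)
  moreover have "(2 powr (q / 2)) powr (1 / q) = sqrt 2"
    using q by (simp add: powr_powr powr_half_sqrt)
  ultimately show ?thesis using n by simp
qed

lemma p_norm_infinity:
  "p_norm \<infinity> (vector [x, y, z] :: real ^ 3) = max \<bar>x\<bar> (max \<bar>y\<bar> \<bar>z\<bar>)"
  by (simp add: p_norm_def UNIV_3 insert_commute max.commute max.left_commute)

lemma two_sqrt_2: "2 * sqrt 2 = 2 powr (3/2)"
  using powr_add[of "2::real" 1 "1/2"] by (simp add: powr_half_sqrt)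

text \<open>\<open>\<Sum>x\<^sup>q\<close> is log-convex in \<open>q\<close>: this reduces an upper bound \<open>2 powr (1 + q / 2)\<close> for such a sum,
  \<open>1 \<le> q \<le> 2\<close>, to the cases \<open>q = 1\<close> and \<open>q = 2\<close>.\<close>

lemma powr_le_chord:
  fixes x q :: real
  assumes "1 \<le> q" "q \<le> 2" "0 \<le> x"
  shows "x powr q \<le> 2 powr (1 + q / 2) * ((2 - q) * (x / (2 * sqrt 2)) + (q - 1) * (x\<^sup>2 / 4))"
proof (cases "x = 0")
  case False
  then have x: "x > 0" using assms by simp
  \<comment> \<open>Weighted arithmetic-geometric mean inequality. The divisors are the values of
    \<open>2 powr (1 + q / 2)\<close> at \<open>q = 1\<close> and \<open>q = 2\<close>; their
    geometric mean with these weights is its value at \<open>q\<close>.\<close>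
  have "(x / (2 * sqrt 2)) powr (2 - q) * (x\<^sup>2 / 4) powr (q - 1)
      \<le> (2 - q) * (x / (2 * sqrt 2)) + (q - 1) * (x\<^sup>2 / 4)"
    by (rule Youngs_inequality_0) (use assms x in auto)
  also have "(x / (2 * sqrt 2)) powr (2 - q) * (x\<^sup>2 / 4) powr (q - 1)
     = x powr q / 2 powr (1 + q / 2)"
  proof -
    have "(x / (2 * sqrt 2)) powr (2 - q) = x powr (2 - q) / 2 powr (3/2 * (2 - q))"
      unfolding two_sqrt_2 using x by (simp add: powr_divide powr_powr)
    moreover have "(x\<^sup>2 / 4) powr (q - 1) = (x powr 2) powr (q - 1) / (2 powr 2) powr (q - 1)"
      using x by (simp add: powr_divide)
    then have "(x\<^sup>2 / 4) powr (q - 1) = x powr (2 * (q - 1)) / 2 powr (2 * (q - 1))"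
      by (simp only: powr_powr)
    moreover have "x powr (2 - q) * x powr (2 * (q - 1)) = x powr q"
      by (simp flip: powr_add)
    moreover have "2 powr (3/2 * (2 - q)) * 2 powr (2 * (q - 1)) = (2::real) powr (1 + q / 2)"
      unfolding powr_add[symmetric] by (rule arg_cong[of _ _ "(powr) 2"]) (simp add: field_simps)
    ultimately show ?thesis by simp
  qed
  finally show ?thesis by (simp add: field_simps)
qed simp

abbreviation combine :: "real ^ 3 \<Rightarrow> real ^ 3 \<Rightarrow> real ^ 3 \<Rightarrow> int \<Rightarrow> int \<Rightarrow> int \<Rightarrow> real ^ 3" where
  "combine v0 v1 v2 a b c \<equiv> of_int a *\<^sub>R v0 + of_int b *\<^sub>R v1 + of_int c *\<^sub>R v2"

lemma combine_vector:
  "combine (vector [x0, y0, z0]) (vector [x1, y1, z1]) (vector [x2, y2, z2]) a b c =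
    vector [of_int a * x0 + of_int b * x1 + of_int c * x2, of_int a * y0 + of_int b * y1 + of_int c * y2,
      of_int a * z0 + of_int b * z1 + of_int c * z2]"
  by (simp add: vec_eq_iff forall_3)

text \<open>Since \<open>b\<close> and \<open>c\<close> never have opposite signs, a common sign
  turns a nonzero pair into (1, 0), (0, 1) or (1, 1): up to sign, the three sides of the
  triangle.\<close>

lemma sign_triple_cases:
  fixes a b c :: int
  assumes "a \<in> {-1, 0, 1}" "b \<in> {-1, 0, 1}" "c \<in> {-1, 0, 1}" "b * c \<noteq> -1"
    "a \<noteq> 0 \<or> b \<noteq> 0 \<or> c \<noteq> 0"
    and "\<And>s. s \<in> {-1, 1} \<Longrightarrow> P s 0 0"
    and "\<And>r s b c. r \<in> {-1, 0, 1} \<Longrightarrow> s \<in> {-1, 1} \<Longrightarrow> (b, c) \<in> {(1, 0), (0, 1), (1, 1)} \<Longrightarrow> P r (s * b) (s * c)"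
  shows "P a b c"
proof (cases "b = 0 \<and> c = 0")
  case True
  then show ?thesis using assms(1,5,6) by auto
next
  case False
  then have "\<exists>s\<in>{-1, 1}. (s * b, s * c) \<in> {(1, 0), (0, 1), (1, 1)}"
    using assms(2-4) by auto
  then obtain s where s: "s \<in> {-1, 1}" "(s * b, s * c) \<in> {(1, 0), (0, 1), (1, 1)}" by blast
  then show ?thesis using assms(7)[OF assms(1) s] by auto
qed

text \<open>\<open>v1\<close>, \<open>v2\<close> and \<open>v1 + v2\<close> get norm 1. For
  exponents \<open>q \<ge> 2\<close>, \<open>v0\<close> has a coordinate of its own, since a power
  sum of 2 is at most \<open>2 powr (q / 2)\<close>. For \<open>q < 2\<close> that bound fails;
  there the triangle lies in the plane of coordinate sum 0 and \<open>v0\<close> on the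
  diagonal.\<close>

lemma frame_exists:
  fixes p :: ereal
  assumes "1 \<le> p"
  shows "\<exists>v0 v1 v2. \<forall>a b c. a \<in> {-1, 0, 1} \<longrightarrow> b \<in> {-1, 0, 1} \<longrightarrow> c \<in> {-1, 0, 1} \<longrightarrow> b * c \<noteq> -1 \<longrightarrow>
    (a \<noteq> 0 \<or> b \<noteq> 0 \<or> c \<noteq> 0) \<longrightarrow>
    1 \<le> p_norm p (combine v0 v1 v2 a b c) \<and> p_norm p (combine v0 v1 v2 a b c) \<le> sqrt 2"
proof -
  consider "p = \<infinity>" | q where "p = ereal q" "2 \<le> q" | q where "p = ereal q" "1 \<le> q" "q < 2"
    using assms by (cases p) (auto, metis linorder_not_le)
  then show ?thesis
  proof cases
    case 1
    \<comment> \<open>(1, 0, 0), (-1/2, 1, 0) and their sum (1/2, 1, 0) have maximum norm 1, and a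
      third coordinate of at most 1 does not raise it.\<close>
    have "1 \<le> p_norm p (combine (vector [0, 0, 1]) (vector [1, 0, 0]) (vector [-1/2, 1, 0]) a b c) \<and>
      p_norm p (combine (vector [0, 0, 1]) (vector [1, 0, 0]) (vector [-1/2, 1, 0]) a b c) \<le> sqrt 2"
      if "a \<in> {-1, 0, 1}" "b \<in> {-1, 0, 1}" "c \<in> {-1, 0, 1}" "b * c \<noteq> -1" "a \<noteq> 0 \<or> b \<noteq> 0 \<or> c \<noteq> 0" for a b c
    proof -
      have "p_norm p (combine (vector [0, 0, 1]) (vector [1, 0, 0]) (vector [-1/2, 1, 0]) a b c) = 1"
        unfolding 1 combine_vector p_norm_infinity by (rule sign_triple_cases[OF that]) auto
      then show ?thesis by simp
    qed
    then show ?thesis by blast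
  next
    case 2
    \<comment> \<open>\<open>w\<close> is chosen so that the power sum of (1/2, w, 0) is 1.\<close>
    define u where "u = 1 - (1/2) powr q"
    define w where "w = u powr (1 / q)"
    have "(1/2::real) powr q \<le> 1" using 2 by (intro powr_le1) auto
    then have "0 \<le> u" by (simp add: u_def)
    then have wq: "w powr q = u" "w \<ge> 0" using 2 by (auto simp: w_def powr_powr)
    have h: "1/2 powr q = 1 - u" "(1/2) powr q = 1 - u" by (auto simp: u_def powr_divide)
    have two: "2 powr 1 \<le> (2::real) powr (q / 2)" by (rule powr_mono) (use 2 in auto)
    have "1 \<le> p_norm p (combine (vector [0, 0, 1]) (vector [1, 0, 0]) (vector [-1/2, w, 0]) a b c) \<and>
      p_norm p (combine (vector [0, 0, 1]) (vector [1, 0, 0]) (vector [-1/2, w, 0]) a b c) \<le> sqrt 2"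
      if "a \<in> {-1, 0, 1}" "b \<in> {-1, 0, 1}" "c \<in> {-1, 0, 1}" "b * c \<noteq> -1" "a \<noteq> 0 \<or> b \<noteq> 0 \<or> c \<noteq> 0" for a b c
      unfolding combine_vector 2(1)
      by (rule p_norm_real_bounds; (rule sign_triple_cases[OF that])?)
        (use 2(2) wq h two in \<open>auto\<close>)
    then show ?thesis by blast
  next
    case 3
    \<comment> \<open>\<open>\<alpha>\<close> is the orthonormal choice for \<open>q = 2\<close>; it just suffices at \<open>q = 1\<close>, where the largest norm
      is \<open>2 + \<alpha> < 2 \<surd>2\<close> (before scaling by \<open>\<kappa>\<close>).\<close>
    define \<alpha> :: real where "\<alpha> = sqrt (2/3)"
    \<comment> \<open>Scaling by \<open>\<kappa>\<close> halves all power sums: (1, -1, 0) gets norm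
      1, and the bounds on unscaled sums become 2 and \<open>M\<close>.\<close>
    define \<kappa> :: real where "\<kappa> = (1/2) powr (1 / q)"
    have \<kappa>: "\<kappa> \<ge> 0" "\<kappa> powr q = 1/2" using 3 by (auto simp: \<kappa>_def powr_powr)
    have a2: "\<alpha>\<^sup>2 = 2/3" by (simp add: \<alpha>_def)
    have a0: "1/2 < \<alpha>" unfolding \<alpha>_def by (rule real_less_rsqrt) (simp add: power2_eq_square)
    \<comment> \<open>The decimals meet exactly, 2 + 0.82 = 2 * 1.41, which gives
      \<open>2 + \<alpha> \<le> 2 * sqrt 2\<close>.\<close>
    have a1: "\<alpha> \<le> 0.82" unfolding \<alpha>_def by (rule real_le_lsqrt) (simp_all add: power2_eq_square)
    have r2: "1.41 \<le> sqrt 2" by (rule real_le_rsqrt) (simp add: power2_eq_square)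
    define M :: real where "M = 2 powr (1 + q / 2)"
    have M: "2 powr (q / 2) = M / 2" by (simp add: M_def powr_add)
    have M2: "2 * sqrt 2 \<le> M" unfolding M_def two_sqrt_2 by (rule powr_mono) (use 3 in auto)
    have sq: "\<alpha>\<^sup>2 \<le> \<alpha> powr q" "(1 - \<alpha>)\<^sup>2 \<le> (1 - \<alpha>) powr q"
      using powr_mono'[of q 2 \<alpha>] powr_mono'[of q 2 "1 - \<alpha>"] a0 a1 3 by simp_all
    have lin: "\<alpha> powr q \<le> \<alpha>" using powr_mono'[of 1 q \<alpha>] a0 a1 3 by simp
    have lin': "1 + \<alpha> \<le> (1 + \<alpha>) powr q" using powr_mono[of 1 q "1 + \<alpha>"] a0 3 by simp
    \<comment> \<open>\<open>T\<close> is the unscaled power sum of \<open>v0\<close> plus or minus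
      a side of the triangle: the coordinates are permuted and change sign, but their absolute
      values stay the same. \<open>U\<close> below treats \<open>v0\<close> alone and a side
      alone.\<close>
    define T where "T = (1 + \<alpha>) powr q + (1 - \<alpha>) powr q + \<alpha> powr q"
    have T1: "2 \<le> T"
      using sq lin' a1 a2 power2_diff[of 1 \<alpha>] unfolding T_def by simp
    have T2: "T \<le> M"
    proof -
      note c = powr_le_chord[of q, folded M_def]
      have "T \<le> M * ((2 - q) * ((2 + \<alpha>) / (2 * sqrt 2)) + (q - 1) * ((2 + 3 * \<alpha>\<^sup>2) / 4))"
        using c[of "1 + \<alpha>"] c[of "1 - \<alpha>"] c[of \<alpha>] a0 a1 3 unfolding T_def
        by (simp add: power2_eq_square algebra_simps add_divide_distrib diff_divide_distrib)
      also have "\<dots> \<le> M * ((2 - q) * 1 + (q - 1) * 1)"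
        by (intro mult_left_mono add_mono) (use a1 a2 r2 3 in \<open>auto simp: M_def\<close>)
      finally show ?thesis by simp
    qed
    have U: "2 \<le> 3 * \<alpha> powr q" "3 * \<alpha> powr q \<le> M" "2 \<le> M"
      using sq a2 lin a1 r2 M2 by linarith+
    have n: "\<bar>\<kappa> * y\<bar> powr q = \<bar>y\<bar> powr q / 2" for y using \<kappa> by (simp add: abs_mult powr_mult)
    define v0 v1 v2 :: "real ^ 3" where "v0 = vector [\<kappa> * \<alpha>, \<kappa> * \<alpha>, \<kappa> * \<alpha>]"
      and "v1 = vector [\<kappa> * 1, \<kappa> * -1, \<kappa> * 0]" and "v2 = vector [\<kappa> * 0, \<kappa> * 1, \<kappa> * -1]"
    have comb: "combine v0 v1 v2 a b c = vector [\<kappa> * (a * \<alpha> + b), \<kappa> * (a * \<alpha> - b + c), \<kappa> * (a * \<alpha> - c)]" for a b c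
      unfolding v0_def v1_def v2_def combine_vector by (simp add: algebra_simps)
    have ab: "\<bar>\<alpha>\<bar> = \<alpha>" "\<bar>\<alpha> + 1\<bar> = 1 + \<alpha>" "\<bar>\<alpha> - 1\<bar> = 1 - \<alpha>" "\<bar>1 - \<alpha>\<bar> = 1 - \<alpha>" "\<bar>- \<alpha> - 1\<bar> = 1 + \<alpha>"
      "\<bar>1 + \<alpha>\<bar> = 1 + \<alpha>" "\<bar>-1 - \<alpha>\<bar> = 1 + \<alpha>" "\<bar>-1 + \<alpha>\<bar> = 1 - \<alpha>" "\<bar>- \<alpha> + 1\<bar> = 1 - \<alpha>"
      using a0 a1 by auto
    have "1 \<le> p_norm p (combine v0 v1 v2 a b c) \<and> p_norm p (combine v0 v1 v2 a b c) \<le> sqrt 2"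
      if "a \<in> {-1, 0, 1}" "b \<in> {-1, 0, 1}" "c \<in> {-1, 0, 1}" "b * c \<noteq> -1" "a \<noteq> 0 \<or> b \<noteq> 0 \<or> c \<noteq> 0" for a b c
    proof -
      have "2 \<le> \<bar>a * \<alpha> + b\<bar> powr q + \<bar>a * \<alpha> - b + c\<bar> powr q + \<bar>a * \<alpha> - c\<bar> powr q \<and>
        \<bar>a * \<alpha> + b\<bar> powr q + \<bar>a * \<alpha> - b + c\<bar> powr q + \<bar>a * \<alpha> - c\<bar> powr q \<le> M"
        by (rule sign_triple_cases[OF that]) (use U T1 T2 in \<open>auto simp: ab T_def\<close>)
      then show ?thesis
        unfolding comb 3(1) by (intro p_norm_real_bounds) (use 3 in \<open>auto simp: n M\<close>)
    qed
    then show ?thesis by blast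
  qed
qed

section \<open>Flows of bridgeless graphs\<close>

text \<open>If \<open>e\<close> is the only edge of the cut, \<open>S\<close> is closed under
  adjacency once \<open>e\<close> is deleted, so \<open>e\<close> separates its ends.\<close>

lemma card_cut_bridgeless:
  fixes G :: "('v, 'e) mgraph"
  assumes "bridgeless G" and ends: "\<And>e. e \<in> edges G \<Longrightarrow> ends G e = {t e, h e}"
  shows "card (cut t h (edges G) S) \<noteq> 1"
proof
  assume "card (cut t h (edges G) S) = 1"
  then obtain e where c: "cut t h (edges G) S = {e}" by (auto simp: card_1_singleton_iff)
  then have e: "e \<in> edges G" "(t e \<in> S) \<noteq> (h e \<in> S)" unfolding cut_def by auto
  obtain u v where uv: "ends G e = {u, v}" "u \<in> S" "v \<notin> S"
    using e(2) ends[OF e(1)] by (metis insert_commute)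
  have step: "y \<in> S" if xy: "(x, y) \<in> adjacency (delete_edge G e)" and x: "x \<in> S" for x y
  proof -
    obtain a where a: "a \<in> edges G" "a \<noteq> e" "ends G a = {x, y}"
      using xy by (auto simp: adjacency_def delete_edge_def)
    have "a \<notin> cut t h (edges G) S" using c a(2) by auto
    then show ?thesis using a(1,3) ends[OF a(1)] x by (auto simp: cut_def doubleton_eq_iff)
  qed
  have "y \<in> S" if "(u, y) \<in> (adjacency (delete_edge G e))\<^sup>*" for y
    using that by induction (use uv(2) step in auto)
  then have "bridge G e" using e(1) uv unfolding bridge_def by blast
  then show False using assms(1) by (simp add: bridgeless_def)
qed

theorem theorem3p2:
  fixes G :: "('v, 'e) mgraph" and p :: ereal
  assumes "finite_multigraph G" and "bridgeless G" and "1 \<le> p"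
  shows "flow_number TYPE(3) p G \<le> ereal (1 + sqrt 2)"
proof -
  have fin: "finite (edges G)" and two: "\<And>e. e \<in> edges G \<Longrightarrow> card (ends G e) = 2"
    using assms(1) by (auto simp: finite_multigraph_def)
  have "\<forall>e. \<exists>x y. e \<in> edges G \<longrightarrow> ends G e = {x, y}" using two by (metis card_2_iff)
  \<comment> \<open>Any orientation will do, as the integer flows may take either sign.\<close>
  then obtain t h where th: "\<And>e. e \<in> edges G \<Longrightarrow> ends G e = {t e, h e}" by metis
  have cuts: "card (cut t h (edges G) S) \<noteq> 1" for S
    by (rule card_cut_bridgeless[OF assms(2) th])
  obtain f0 f1 f2 :: "'e \<Rightarrow> int" where
    bd: "\<forall>v. bd t h (edges G) f0 v = 0 \<and> bd t h (edges G) f1 v = 0 \<and> bd t h (edges G) f2 v = 0"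
    and f: "\<forall>e\<in>edges G. f0 e \<in> {-1, 0, 1} \<and> f1 e \<in> {-1, 0, 1} \<and> f2 e \<in> {-1, 0, 1} \<and>
      f1 e * f2 e \<noteq> -1 \<and> (f0 e \<noteq> 0 \<or> f1 e \<noteq> 0 \<or> f2 e \<noteq> 0)"
    using integer_six_flow[OF fin cuts] by (elim exE conjE) (rule that)
  obtain v0 v1 v2 :: "real ^ 3" where
    frame: "\<forall>a b c. a \<in> {-1, 0, 1} \<longrightarrow> b \<in> {-1, 0, 1} \<longrightarrow> c \<in> {-1, 0, 1} \<longrightarrow> b * c \<noteq> -1 \<longrightarrow>
      (a \<noteq> 0 \<or> b \<noteq> 0 \<or> c \<noteq> 0) \<longrightarrow>
      1 \<le> p_norm p (combine v0 v1 v2 a b c) \<and> p_norm p (combine v0 v1 v2 a b c) \<le> sqrt 2"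
    using frame_exists[OF assms(3)] by (elim exE) (rule that)
  define F where "F e = combine v0 v1 v2 (f0 e) (f1 e) (f2 e)" for e
  define D where "D = \<lparr>verts = vertices G, arcs = edges G, tail = t, head = h\<rparr>"
  have norms: "1 \<le> p_norm p (F e) \<and> p_norm p (F e) \<le> sqrt 2" if "e \<in> edges G" for e
    using bspec[OF f that] unfolding F_def by (elim conjE) (rule frame[rule_format])
  \<comment> \<open>So the lower norm bound already excludes the zero vector.\<close>
  have "p_norm p (0 :: real ^ 3) = 0"
    by (simp add: p_norm_def)
  then have "F e \<noteq> 0" if "e \<in> edges G" for e using norms[OF that] by auto
  moreover have "(\<Sum>e\<in>out_arcs D v. F e) - (\<Sum>e\<in>in_arcs D v. F e) = 0" for v
  proof -
    have "(\<Sum>e\<in>out_arcs D v. F e) - (\<Sum>e\<in>in_arcs D v. F e) = bd t h (edges G) F v"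
      using fin by (simp add: bd_def D_def out_arcs_def in_arcs_def sum_subtractf sum.inter_filter)
    also have "\<dots> = of_int (bd t h (edges G) f0 v) *\<^sub>R v0 + of_int (bd t h (edges G) f1 v) *\<^sub>R v1
        + of_int (bd t h (edges G) f2 v) *\<^sub>R v2"
      unfolding F_def bd_add bd_scaleR bd_of_int ..
    finally show ?thesis by (simp add: bd)
  qed
  ultimately have "vector_flow (UNIV - {0}) G D F"
    using th by (auto simp: vector_flow_def orientation_def D_def)
  then have "nzf (1 + sqrt 2) p G D F" using norms by (simp add: nzf_def)
  then have "1 + sqrt 2 \<in> {r. 2 \<le> r \<and> (\<exists>D (f :: 'e \<Rightarrow> real ^ 3). nzf r p G D f)}"
    by auto
  then show ?thesis unfolding flow_number_def by (rule INF_lower)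
qed

end
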